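(* Let $G$ be a linear algebraic group over an algebraically closed field $\Bbbk$ of characteristic $0$, with identity component $G^0$. If $\sigma(G)$ is finite, then $G^0$ is unipotent, i.e. either $G$ is finite or $G^0$ is infinite unipotent.
   Context: A $G$-module is a finite-dimensional rational representation $V$ of $G$ over $\Bbbk$. $\Bbbk[V]\cong S(V^* )$ is the ring of polynomial functions on $V$, with $G$-action $(g\cdot f)(v)=f(g^{-1}v)$ and invariant ring $\Bbbk[V]^G$, graded by degree. $\Bbbk[V]^G_{\le d}$ is the set of invariants of degree at most $d$. For $S\subseteq \Bbbk[V]$, $S_+$ is the set of elements of $S$ with constant term zero. The nullcone $\mathcal{N}_{G,V}\subseteq V$ is the common zero set of $\Bbbk[V]^G_+$. A subset $S\subseteq\Bbbk[V]^G$ is a $\sigma$-set if for every $v\in V\setminus\mathcal{N}_{G,V}$ there is $f\in S_+$ with $f(v)\neq 0$. Define $\sigma(G,V)=\min\{d\ge 0 : \Bbbk[V]^G_{\le d}\text{ is a }\sigma\text{-set}\}$ and $\sigma(G)=\sup\{\sigma(G,V): V\text{ a }G\text{-module}\}$ (equal to $\infty$ if unbounded). *)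

theory Defs
  imports
    "HOL-Analysis.Abstract_Topology_2"
    "HOL-Library.Extended_Nat"
    "HOL-Algebra.Group"
    "Jordan_Normal_Form.Determinant"
begin

section \<open>Polynomial functions\<close>

definition exponents :: "'i set \<Rightarrow> nat \<Rightarrow> ('i \<Rightarrow> nat) set" where
  "exponents I d = {\<alpha> \<in> I \<rightarrow>\<^sub>E UNIV. sum \<alpha> I \<le> d}"

text \<open>Polynomial functions of degree at most \<open>d\<close> in the coordinates indexed by the finite set
  \<open>I\<close>. The coefficient families \<open>c\<close> are arbitrary, since the sum is over a finite set of
  exponents.\<close>

definition polyfun_le :: "'i set \<Rightarrow> nat \<Rightarrow> (('i \<Rightarrow> 'k::comm_ring_1) \<Rightarrow> 'k) set" where
  "polyfun_le I d = {\<lambda>x. \<Sum>\<alpha>\<in>exponents I d. c \<alpha> * (\<Prod>i\<in>I. x i ^ \<alpha> i) | c. True}"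

definition polyfun :: "'i set \<Rightarrow> (('i \<Rightarrow> 'k::comm_ring_1) \<Rightarrow> 'k) set" where
  "polyfun I = (\<Union>d. polyfun_le I d)"

definition mat_poly :: "nat \<Rightarrow> ('k::comm_ring_1 mat \<Rightarrow> 'k) set" where
  "mat_poly m = {\<lambda>A. p (\<lambda>ij. A $$ ij) | p. p \<in> polyfun ({..<m} \<times> {..<m})}"


section \<open>Linear algebraic groups\<close>

definition GL :: "nat \<Rightarrow> 'k::field mat monoid" where
  "GL m = units_of (ring_mat TYPE('k) m ())"

definition zero_locus :: "nat \<Rightarrow> ('k::field mat \<Rightarrow> 'k) set \<Rightarrow> 'k mat set" where
  "zero_locus m P = {A \<in> carrier (GL m). \<forall>p\<in>P. p A = 0}"

text \<open>The regular functions on \<open>GL m\<close> are the quotients of polynomials in the matrix entries by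
  powers of the determinant, so polynomials in the entries suffice to cut out the closed sets.
  That this is a topology is \<open>istopology_zariski\<close> below.\<close>

definition zariski :: "nat \<Rightarrow> 'k::field mat topology" where
  "zariski m = topology (\<lambda>U. \<exists>P\<subseteq>mat_poly m. U = carrier (GL m) - zero_locus m P)"

definition linear_algebraic_group :: "nat \<Rightarrow> 'k::field mat set \<Rightarrow> bool" where
  "linear_algebraic_group m G \<longleftrightarrow> subgroup G (GL m) \<and> closedin (zariski m) G"

definition identity_component :: "nat \<Rightarrow> 'k::field mat set \<Rightarrow> 'k mat set" where
  "identity_component m G = connected_component_of_set (subtopology (zariski m) G) (1\<^sub>m m)"

definition unipotent :: "nat \<Rightarrow> 'k::field mat set \<Rightarrow> bool" where
  "unipotent m H \<longleftrightarrow> (\<forall>A\<in>H. \<exists>k. (A - 1\<^sub>m m) ^\<^sub>m k = 0\<^sub>m m m)"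


section \<open>Modules and invariants\<close>

text \<open>A \<open>G\<close>-module of dimension \<open>n\<close>, with a basis chosen: a homomorphism \<open>\<rho>\<close> from \<open>G\<close> to
  \<open>GL n\<close> whose matrix entries are regular functions on \<open>G\<close>; the underlying space \<open>V\<close> is
  \<open>carrier_vec n\<close>. The values of \<open>\<rho>\<close> outside \<open>G\<close> play no role.\<close>

definition G_module ::
  "nat \<Rightarrow> 'k::field mat set \<Rightarrow> nat \<Rightarrow> ('k mat \<Rightarrow> 'k mat) \<Rightarrow> bool" where
  "G_module m G n \<rho> \<longleftrightarrow>
     \<rho> \<in> hom ((GL m)\<lparr>carrier := G\<rparr>) (GL n) \<and>
     (\<forall>i<n. \<forall>j<n. \<exists>p\<in>mat_poly m. \<exists>N. \<forall>g\<in>G. \<rho> g $$ (i, j) = p g / det g ^ N)"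

definition coord_ring_le :: "nat \<Rightarrow> nat \<Rightarrow> ('k::field vec \<Rightarrow> 'k) set" where
  "coord_ring_le n d = {\<lambda>v\<in>carrier_vec n. p (\<lambda>i. v $ i) | p. p \<in> polyfun_le {..<n} d}"

definition coord_ring :: "nat \<Rightarrow> ('k::field vec \<Rightarrow> 'k) set" where
  "coord_ring n = {\<lambda>v\<in>carrier_vec n. p (\<lambda>i. v $ i) | p. p \<in> polyfun {..<n}}"

definition act ::
  "nat \<Rightarrow> nat \<Rightarrow> ('k::field mat \<Rightarrow> 'k mat) \<Rightarrow> 'k mat \<Rightarrow> ('k vec \<Rightarrow> 'k) \<Rightarrow> 'k vec \<Rightarrow> 'k" where
  "act m n \<rho> g f = (\<lambda>v\<in>carrier_vec n. f (\<rho> (inv\<^bsub>GL m\<^esub> g) *\<^sub>v v))"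

definition invariants ::
  "nat \<Rightarrow> 'k::field mat set \<Rightarrow> nat \<Rightarrow> ('k mat \<Rightarrow> 'k mat) \<Rightarrow> ('k vec \<Rightarrow> 'k) set" where
  "invariants m G n \<rho> = {f \<in> coord_ring n. \<forall>g\<in>G. act m n \<rho> g f = f}"

definition invariants_le ::
  "nat \<Rightarrow> 'k::field mat set \<Rightarrow> nat \<Rightarrow> ('k mat \<Rightarrow> 'k mat) \<Rightarrow> nat \<Rightarrow> ('k vec \<Rightarrow> 'k) set" where
  "invariants_le m G n \<rho> d = invariants m G n \<rho> \<inter> coord_ring_le n d"

text \<open>The constant term of a polynomial function is its value at the origin.\<close>

definition plus_part :: "nat \<Rightarrow> ('k::field vec \<Rightarrow> 'k) set \<Rightarrow> ('k vec \<Rightarrow> 'k) set" where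
  "plus_part n S = {f \<in> S. f (0\<^sub>v n) = 0}"

definition nullcone ::
  "nat \<Rightarrow> 'k::field mat set \<Rightarrow> nat \<Rightarrow> ('k mat \<Rightarrow> 'k mat) \<Rightarrow> 'k vec set" where
  "nullcone m G n \<rho> = {v \<in> carrier_vec n. \<forall>f\<in>plus_part n (invariants m G n \<rho>). f v = 0}"

definition sigma_set ::
  "nat \<Rightarrow> 'k::field mat set \<Rightarrow> nat \<Rightarrow> ('k mat \<Rightarrow> 'k mat) \<Rightarrow> ('k vec \<Rightarrow> 'k) set \<Rightarrow> bool" where
  "sigma_set m G n \<rho> S \<longleftrightarrow>
     S \<subseteq> invariants m G n \<rho> \<and>
     (\<forall>v \<in> carrier_vec n - nullcone m G n \<rho>. \<exists>f\<in>plus_part n S. f v \<noteq> 0)"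

text \<open>An infimum in \<open>enat\<close> of a nonempty set is its minimum; the set is nonempty here because the
  nullcone is already the zero set of finitely many invariants.\<close>

definition sigma_module ::
  "nat \<Rightarrow> 'k::field mat set \<Rightarrow> nat \<Rightarrow> ('k mat \<Rightarrow> 'k mat) \<Rightarrow> enat" where
  "sigma_module m G n \<rho> = (INF d\<in>{d. sigma_set m G n \<rho> (invariants_le m G n \<rho> d)}. enat d)"

definition sigma_group :: "nat \<Rightarrow> 'k::field mat set \<Rightarrow> enat" where
  "sigma_group m G = (SUP (n, \<rho>)\<in>{(n, \<rho>). G_module m G n \<rho>}. sigma_module m G n \<rho>)"


section \<open>The Zariski topology is a topology\<close>

lemma finite_exponents:
  assumes "finite I"
  shows "finite (exponents I d)"
proof (rule finite_subset)
  show "exponents I d \<subseteq> I \<rightarrow>\<^sub>E {..d}"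
  proof
    fix \<alpha> assume a: "\<alpha> \<in> exponents I d"
    have "\<alpha> i \<le> d" if "i \<in> I" for i
      using member_le_sum[of i I \<alpha>] that assms a unfolding exponents_def by fastforce
    then show "\<alpha> \<in> I \<rightarrow>\<^sub>E {..d}"
      using a unfolding exponents_def by (auto simp: PiE_iff)
  qed
  show "finite (I \<rightarrow>\<^sub>E {..d})" using assms by (intro finite_PiE) auto
qed

lemma polyfun_le_0: "(\<lambda>x. 0) \<in> polyfun_le I d"
  unfolding polyfun_le_def by (rule CollectI, rule exI[of _ "\<lambda>_. 0"]) simp

lemma polyfun_le_add:
  assumes "p \<in> polyfun_le I d" "q \<in> polyfun_le I d"
  shows "(\<lambda>x. p x + q x) \<in> polyfun_le I d"
proof -
  obtain c where p: "p = (\<lambda>x. \<Sum>\<alpha>\<in>exponents I d. c \<alpha> * (\<Prod>i\<in>I. x i ^ \<alpha> i))"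
    using assms(1) unfolding polyfun_le_def by auto
  obtain c' where q: "q = (\<lambda>x. \<Sum>\<alpha>\<in>exponents I d. c' \<alpha> * (\<Prod>i\<in>I. x i ^ \<alpha> i))"
    using assms(2) unfolding polyfun_le_def by auto
  show ?thesis
    unfolding polyfun_le_def p q
    by (rule CollectI, rule exI[of _ "\<lambda>\<alpha>. c \<alpha> + c' \<alpha>"])
       (simp add: sum.distrib distrib_right)
qed

lemma polyfun_le_sum:
  assumes "\<And>a. a \<in> A \<Longrightarrow> p a \<in> polyfun_le I d"
  shows "(\<lambda>x. \<Sum>a\<in>A. p a x) \<in> polyfun_le I d"
  using assms
proof (induction A rule: infinite_finite_induct)
  case (insert a A)
  then have "(\<lambda>x. p a x + (\<Sum>a\<in>A. p a x)) \<in> polyfun_le I d"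
    by (intro polyfun_le_add) simp_all
  then show ?case using insert.hyps by simp
qed (simp_all add: polyfun_le_0)

lemma polyfun_le_monom:
  assumes "finite I" "sum \<alpha> I \<le> d"
  shows "(\<lambda>x. c * (\<Prod>i\<in>I. x i ^ \<alpha> i)) \<in> polyfun_le I d"
proof -
  define \<beta> where "\<beta> = restrict \<alpha> I"
  have b: "\<beta> \<in> exponents I d"
    using assms(2) unfolding exponents_def \<beta>_def by (auto simp: PiE_iff)
  have "c * (\<Prod>i\<in>I. x i ^ \<alpha> i)
        = (\<Sum>\<gamma>\<in>exponents I d. (if \<gamma> = \<beta> then c else 0) * (\<Prod>i\<in>I. x i ^ \<gamma> i))" for x
  proof -
    have "(\<Sum>\<gamma>\<in>exponents I d. (if \<gamma> = \<beta> then c else 0) * (\<Prod>i\<in>I. x i ^ \<gamma> i))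
          = (\<Sum>\<gamma>\<in>exponents I d. if \<gamma> = \<beta> then c * (\<Prod>i\<in>I. x i ^ \<beta> i) else 0)"
      by (intro sum.cong) auto
    also have "\<dots> = c * (\<Prod>i\<in>I. x i ^ \<beta> i)"
      using b finite_exponents[OF assms(1)] by simp
    also have "\<dots> = c * (\<Prod>i\<in>I. x i ^ \<alpha> i)"
      unfolding \<beta>_def by (simp cong: prod.cong)
    finally show ?thesis by simp
  qed
  then show ?thesis
    unfolding polyfun_le_def by (intro CollectI exI[of _ "\<lambda>\<gamma>. if \<gamma> = \<beta> then c else 0"]) auto
qed

lemma polyfun_le_mult:
  assumes "finite I" "p \<in> polyfun_le I d" "q \<in> polyfun_le I e"
  shows "(\<lambda>x. p x * q x) \<in> polyfun_le I (d + e)"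
proof -
  obtain c where p: "p = (\<lambda>x. \<Sum>\<alpha>\<in>exponents I d. c \<alpha> * (\<Prod>i\<in>I. x i ^ \<alpha> i))"
    using assms(2) unfolding polyfun_le_def by auto
  obtain c' where q: "q = (\<lambda>x. \<Sum>\<beta>\<in>exponents I e. c' \<beta> * (\<Prod>i\<in>I. x i ^ \<beta> i))"
    using assms(3) unfolding polyfun_le_def by auto
  have "(\<lambda>x. p x * q x) = (\<lambda>x. \<Sum>\<alpha>\<in>exponents I d. \<Sum>\<beta>\<in>exponents I e.
          (c \<alpha> * c' \<beta>) * (\<Prod>i\<in>I. x i ^ (\<alpha> i + \<beta> i)))"
    unfolding p q sum_product
    by (intro ext sum.cong refl) (simp add: power_add prod.distrib mult_ac)
  moreover have "\<dots> \<in> polyfun_le I (d + e)"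
    by (intro polyfun_le_sum polyfun_le_monom assms(1))
       (auto simp: exponents_def sum.distrib)
  ultimately show ?thesis by simp
qed

lemma mat_poly_mult:
  assumes "p \<in> mat_poly m" "q \<in> mat_poly m"
  shows "(\<lambda>A. p A * q A) \<in> mat_poly m"
proof -
  let ?I = "{..<m} \<times> {..<m}"
  obtain p' d where p: "p = (\<lambda>A. p' (\<lambda>ij. A $$ ij))" "p' \<in> polyfun_le ?I d"
    using assms(1) unfolding mat_poly_def polyfun_def by auto
  obtain q' e where q: "q = (\<lambda>A. q' (\<lambda>ij. A $$ ij))" "q' \<in> polyfun_le ?I e"
    using assms(2) unfolding mat_poly_def polyfun_def by auto
  have "(\<lambda>x. p' x * q' x) \<in> polyfun ?I"
    using polyfun_le_mult[OF _ p(2) q(2)] unfolding polyfun_def by auto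
  then show ?thesis
    unfolding mat_poly_def p(1) q(1) by (intro CollectI exI[of _ "\<lambda>x. p' x * q' x"]) auto
qed

lemma mat_poly_const: "(\<lambda>A. c) \<in> mat_poly m"
proof -
  have "(\<lambda>x. c) \<in> polyfun ({..<m} \<times> {..<m})"
    using polyfun_le_monom[of "{..<m} \<times> {..<m}" "\<lambda>_. 0" 0 c] unfolding polyfun_def by auto
  then show ?thesis
    unfolding mat_poly_def by (intro CollectI exI[of _ "\<lambda>x. c"]) auto
qed

lemma istopology_zariski:
  "istopology (\<lambda>U. \<exists>P\<subseteq>mat_poly m. U = carrier (GL m) - zero_locus m (P :: ('k::field mat \<Rightarrow> 'k) set))"
  unfolding istopology_def
proof (intro conjI allI impI)
  fix S T :: "'k mat set"
  assume "\<exists>P\<subseteq>mat_poly m. S = carrier (GL m) - zero_locus m P"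
    and "\<exists>P\<subseteq>mat_poly m. T = carrier (GL m) - zero_locus m P"
  then obtain P Q where P: "P \<subseteq> mat_poly m" "S = carrier (GL m) - zero_locus m P"
    and Q: "Q \<subseteq> mat_poly m" "T = carrier (GL m) - zero_locus m Q"
    by blast
  let ?R = "{\<lambda>A. p A * q A | p q. p \<in> P \<and> q \<in> Q}"
  have "?R \<subseteq> mat_poly m" using P(1) Q(1) mat_poly_mult by blast
  moreover have "S \<inter> T = carrier (GL m) - zero_locus m ?R"
    unfolding P(2) Q(2) zero_locus_def
    by (auto; metis mult_eq_0_iff)
  ultimately show "\<exists>P\<subseteq>mat_poly m. S \<inter> T = carrier (GL m) - zero_locus m P" by blast
next
  fix \<K> :: "'k mat set set"
  assume "\<forall>K\<in>\<K>. \<exists>P\<subseteq>mat_poly m. K = carrier (GL m) - zero_locus m P"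
  then obtain F where F: "\<And>K. K \<in> \<K> \<Longrightarrow> F K \<subseteq> mat_poly m"
    "\<And>K. K \<in> \<K> \<Longrightarrow> K = carrier (GL m) - zero_locus m (F K)"
    by metis
  have "\<Union>\<K> = (\<Union>K\<in>\<K>. carrier (GL m) - zero_locus m (F K))"
    using F(2) by blast
  also have "\<dots> = carrier (GL m) - zero_locus m (\<Union>K\<in>\<K>. F K)"
    unfolding zero_locus_def by auto
  finally show "\<exists>P\<subseteq>mat_poly m. \<Union>\<K> = carrier (GL m) - zero_locus m P"
    using F(1) by (intro exI[of _ "\<Union>K\<in>\<K>. F K"]) auto
qed

lemma openin_zariski:
  "openin (zariski m) U \<longleftrightarrow> (\<exists>P\<subseteq>mat_poly m. U = carrier (GL m) - zero_locus m P)"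
  unfolding zariski_def topology_inverse'[OF istopology_zariski] by (rule refl)

lemma topspace_zariski: "topspace (zariski m) = carrier (GL m)"
proof
  show "topspace (zariski m) \<subseteq> carrier (GL m)"
    unfolding topspace_def openin_zariski by auto
  have "zero_locus m {\<lambda>A. 1} = {}" unfolding zero_locus_def by auto
  then have "openin (zariski m) (carrier (GL m))"
    unfolding openin_zariski using mat_poly_const[of 1]
    by (intro exI[of _ "{\<lambda>A. 1}"]) auto
  then show "carrier (GL m) \<subseteq> topspace (zariski m)" by (rule openin_subset)
qed

lemma closedin_zariski:
  "closedin (zariski m) Z \<longleftrightarrow> (\<exists>P\<subseteq>mat_poly m. Z = zero_locus m P)"
proof -
  have "zero_locus m P \<subseteq> carrier (GL m)" for P :: "('a mat \<Rightarrow> 'a) set"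
    unfolding zero_locus_def by auto
  then show ?thesis
    unfolding closedin_def openin_zariski topspace_zariski
    by (metis double_diff order_refl)
qed

end

theory Submission
  imports Defs "Jordan_Normal_Form.Char_Poly"
begin

text \<open>
  Let \<open>W\<close> be the natural module of \<open>G\<close>, suppose that \<open>\<sigma>(G) \<le> D\<close>, and put \<open>b = D + 1\<close>. On the
  direct sum of the dual of \<open>W\<close> and the \<open>b\<close>-th tensor power of \<open>W\<close> there is the invariant
  \<open>(u, c) \<mapsto> c(u, \<dots>, u)\<close> of degree \<open>b + 1\<close>. Let \<open>g \<in> G\<close> have the eigenvector \<open>w\<close> with eigenvalue
  \<open>\<mu>\<close>, and let \<open>\<phi>\<close> be a generalized left eigenvector for \<open>\<mu>\<close> with \<open>\<phi>(w) = 1\<close>. This invariant is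
  \<open>1\<close> at the point with components \<open>\<phi>\<close> and the \<open>b\<close>-th tensor power of \<open>w\<close>. If the order of \<open>\<mu>\<close>
  exceeds \<open>b D\<close>, comparing weights along the powers of \<open>g\<close> shows that all invariants of degree at
  most \<open>D\<close> without constant term vanish there, a contradiction. Hence the eigenvalues of all elements
  of \<open>G\<close> are \<open>N\<close>-th roots of unity for one common \<open>N\<close>.

  It follows that the unipotent elements form an open and closed subset of \<open>G\<close>, so that the identity
  component is unipotent. If \<open>G\<close> contains a unipotent \<open>u \<noteq> 1\<close>, then the powers of \<open>u\<close> form an
  infinite irreducible set, because their entries are polynomials in the exponent. Otherwise
  \<open>G - {1}\<close> is the zero set in \<open>G\<close> of a single polynomial; its translates by \<open>G\<close> are linearly
  independent and of bounded degree, so that \<open>G\<close> is finite.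
\<close>

section \<open>Exponential polynomial sequences\<close>

text \<open>This is \<open>p(E) x\<close> for the shift operator \<open>(E x) n = x (n + 1)\<close>.
  Sequences become a module over the polynomial ring, and a linear recurrence becomes an
  annihilating polynomial.\<close>

definition shift_poly :: "'a::comm_ring_1 poly \<Rightarrow> (nat \<Rightarrow> 'a) \<Rightarrow> nat \<Rightarrow> 'a" where
  "shift_poly p x = (\<lambda>n. \<Sum>i\<le>degree p. coeff p i * x (n + i))"

lemma shift_poly_0 [simp]: "shift_poly 0 x = (\<lambda>n. 0)"
  by (simp add: shift_poly_def)

lemma shift_poly_pCons [simp]:
  "shift_poly (pCons a p) x = (\<lambda>n. a * x n + shift_poly p x (Suc n))"
proof (cases "p = 0")
  case False
  then show ?thesis
    by (simp add: shift_poly_def sum.atMost_Suc_shift fun_eq_iff del: sum.atMost_Suc)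
qed (simp add: shift_poly_def fun_eq_iff)

lemma shift_poly_1 [simp]: "shift_poly 1 x = x"
  by (simp add: one_pCons)

lemma shift_poly_add: "shift_poly (p + q) x = (\<lambda>n. shift_poly p x n + shift_poly q x n)"
  by (induction p q rule: poly_induct2) (auto simp: fun_eq_iff algebra_simps)

lemma shift_poly_smult: "shift_poly (smult c p) x = (\<lambda>n. c * shift_poly p x n)"
  by (induction p) (auto simp: fun_eq_iff algebra_simps)

lemma shift_poly_sum: "shift_poly (\<Sum>a\<in>A. p a) x = (\<lambda>n. \<Sum>a\<in>A. shift_poly (p a) x n)"
  by (induction A rule: infinite_finite_induct) (auto simp: shift_poly_add fun_eq_iff)

lemma shift_poly_arg_sum:
  "shift_poly p (\<lambda>n. \<Sum>a\<in>A. x a n) = (\<lambda>n. \<Sum>a\<in>A. shift_poly p (x a) n)"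
  by (induction p) (auto simp: fun_eq_iff sum.distrib sum_distrib_left)

lemma shift_poly_arg_add:
  "shift_poly p (\<lambda>n. x n + y n) = (\<lambda>n. shift_poly p x n + shift_poly p y n)"
  by (induction p) (auto simp: fun_eq_iff algebra_simps)

lemma shift_poly_arg_cmult: "shift_poly p (\<lambda>n. c * x n) = (\<lambda>n. c * shift_poly p x n)"
  by (induction p) (auto simp: fun_eq_iff algebra_simps)

lemma shift_poly_arg_0 [simp]: "shift_poly p (\<lambda>n. 0) = (\<lambda>n. 0)"
  by (simp add: shift_poly_def)

lemma shift_poly_arg_offset: "shift_poly p (\<lambda>n. x (n + k)) = (\<lambda>n. shift_poly p x (n + k))"
  by (simp add: shift_poly_def add_ac)

lemma shift_poly_mult: "shift_poly (p * q) x = shift_poly p (shift_poly q x)"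
  by (induction p) (auto simp: fun_eq_iff shift_poly_add shift_poly_smult)

lemma shift_poly_mult_zero:
  "shift_poly q x = (\<lambda>n. 0) \<Longrightarrow> shift_poly (p * q) x = (\<lambda>n. 0)"
  by (simp add: shift_poly_mult)

lemma shift_poly_geometric: "shift_poly p (\<lambda>n. c * a ^ n) = (\<lambda>n. c * poly p a * a ^ n)"
  by (induction p) (auto simp: fun_eq_iff algebra_simps)

text \<open>Cayley--Hamilton for recurrent sequences: the entries of the adjugate of \<open>X - A\<close> act on
  the sequences through the shift.\<close>

lemma shift_poly_char_poly:
  fixes A :: "'a::comm_ring_1 mat"
  assumes A: "A \<in> carrier_mat m m"
    and rec: "\<And>j n. j < m \<Longrightarrow> x j (Suc n) = (\<Sum>l<m. x l n * A $$ (l, j))"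
    and k: "k < m"
  shows "shift_poly (char_poly A) (x k) = (\<lambda>n. 0)"
proof -
  define C where "C = char_poly_matrix A"
  have C: "C \<in> carrier_mat m m" using A by (simp add: C_def)
  note adj = adj_mat[OF C]
  have C_index: "C $$ (l, j) = (if l = j then [:- A $$ (l, j), 1:] else [:- A $$ (l, j):])"
    if "l < m" "j < m" for l j
    using that A by (simp add: C_def char_poly_matrix_def)
  \<comment> \<open>The recurrence says that \<open>X - A\<close>, acting from the right through the
    shift, annihilates the row of the sequences \<open>x l\<close>, here column by column.\<close>
  have zero: "(\<Sum>l<m. shift_poly (C $$ (l, j)) (x l) n) = 0" if j: "j < m" for j n
  proof -
    have "(\<Sum>l<m. shift_poly (C $$ (l, j)) (x l) n)
        = (\<Sum>l<m. (if l = j then x j (Suc n) else 0) - x l n * A $$ (l, j))"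
      using j by (intro sum.cong) (auto simp: C_index)
    also have "\<dots> = 0" using j rec[OF j] by (simp add: sum_subtractf)
    finally show ?thesis .
  qed
  \<comment> \<open>Multiplying by the adjugate turns \<open>X - A\<close> into the scalar matrix
    \<open>char_poly A\<close>, whose column \<open>k\<close> isolates \<open>x k\<close>.\<close>
  have "(\<Sum>j<m. C $$ (l, j) * adj_mat C $$ (j, k)) = (if l = k then char_poly A else 0)"
    if l: "l < m" for l
  proof -
    have "(C * adj_mat C) $$ (l, k) = (\<Sum>j<m. C $$ (l, j) * adj_mat C $$ (j, k))"
      using l k C adj(1) by (auto simp: scalar_prod_def atLeast0LessThan)
    then show ?thesis
      using l k C unfolding adj(2) by (auto simp: C_def char_poly_def)
  qed
  then have "shift_poly (char_poly A) (x k) n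
      = (\<Sum>l<m. shift_poly (\<Sum>j<m. C $$ (l, j) * adj_mat C $$ (j, k)) (x l) n)" for n
    using k by (simp add: if_distrib[of "\<lambda>p. shift_poly p _ _"] cong: if_cong)
  also have "(\<Sum>l<m. shift_poly (\<Sum>j<m. C $$ (l, j) * adj_mat C $$ (j, k)) (x l) n)
      = (\<Sum>j<m. shift_poly (adj_mat C $$ (j, k)) (\<lambda>n. \<Sum>l<m. shift_poly (C $$ (l, j)) (x l) n) n)"
    for n
    unfolding shift_poly_sum shift_poly_arg_sum
    by (subst sum.swap) (simp add: mult.commute[of "C $$ _"] shift_poly_mult)
  also have "\<dots> n = 0" for n by (simp add: zero)
  finally show ?thesis by (rule ext)
qed

text \<open>In characteristic \<open>0\<close> and for \<open>\<mu> \<noteq> 0\<close>, these are the sequences \<open>\<mu> ^ n * P n\<close> with a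
  polynomial \<open>P\<close>.\<close>

definition exp_poly_seq :: "'a::comm_ring_1 \<Rightarrow> (nat \<Rightarrow> 'a) \<Rightarrow> bool" where
  "exp_poly_seq \<mu> x \<longleftrightarrow> (\<exists>k. shift_poly ([:- \<mu>, 1:] ^ k) x = (\<lambda>n. 0))"

section \<open>Closure properties of exponential polynomial sequences\<close>

lemma exp_poly_seq_0: "exp_poly_seq \<mu> (\<lambda>n. 0)"
  by (auto simp: exp_poly_seq_def)

lemma exp_poly_seq_geometric: "exp_poly_seq \<mu> (\<lambda>n. c * \<mu> ^ n)"
  unfolding exp_poly_seq_def by (rule exI[of _ 1]) (simp add: fun_eq_iff)

lemma exp_poly_seq_const: "exp_poly_seq 1 (\<lambda>n. c)"
  using exp_poly_seq_geometric[of 1 c] by simp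

lemma exp_poly_seq_add:
  assumes "exp_poly_seq \<mu> x" "exp_poly_seq \<mu> y"
  shows "exp_poly_seq \<mu> (\<lambda>n. x n + y n)"
proof -
  obtain k l where k: "shift_poly ([:- \<mu>, 1:] ^ k) x = (\<lambda>n. 0)"
    and l: "shift_poly ([:- \<mu>, 1:] ^ l) y = (\<lambda>n. 0)"
    using assms unfolding exp_poly_seq_def by blast
  have "shift_poly ([:- \<mu>, 1:] ^ (k + l)) (\<lambda>n. x n + y n) = (\<lambda>n. 0)"
    unfolding power_add shift_poly_arg_add shift_poly_mult_zero[OF l]
    unfolding mult.commute[of "[:- \<mu>, 1:] ^ k"] shift_poly_mult_zero[OF k] by simp
  then show ?thesis unfolding exp_poly_seq_def by blast
qed

lemma exp_poly_seq_cmult: "exp_poly_seq \<mu> x \<Longrightarrow> exp_poly_seq \<mu> (\<lambda>n. c * x n)"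
  unfolding exp_poly_seq_def shift_poly_arg_cmult by (metis mult_zero_right)

lemma exp_poly_seq_sum:
  assumes "\<And>a. a \<in> A \<Longrightarrow> exp_poly_seq \<mu> (x a)"
  shows "exp_poly_seq \<mu> (\<lambda>n. \<Sum>a\<in>A. x a n)"
  using assms
  by (induction A rule: infinite_finite_induct) (auto intro: exp_poly_seq_0 exp_poly_seq_add)

text \<open>Twisted Leibniz rule: \<open>(E - \<mu> \<nu>) (x y) = (E - \<mu>) x * E y + \<mu> * x *
  (E - \<nu>) y\<close>. In each summand one of the annihilating exponents has dropped by one, so
  induction on \<open>k + l\<close> applies.\<close>

lemma exp_poly_seq_mult:
  assumes "exp_poly_seq \<mu> x" "exp_poly_seq \<nu> y"
  shows "exp_poly_seq (\<mu> * \<nu>) (\<lambda>n. x n * y n)"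
proof -
  have "exp_poly_seq (\<mu> * \<nu>) (\<lambda>n. x n * y n)"
    if "shift_poly ([:- \<mu>, 1:] ^ k) x = (\<lambda>n. 0)" "shift_poly ([:- \<nu>, 1:] ^ l) y = (\<lambda>n. 0)"
      "N = k + l" for N k l x y
    using that
  proof (induction N arbitrary: k l x y)
    case 0
    then show ?case by (auto simp: exp_poly_seq_0)
  next
    case (Suc N)
    show ?case
    proof (cases "k = 0 \<or> l = 0")
      case True
      then show ?thesis using Suc.prems by (auto simp: exp_poly_seq_0)
    next
      case False
      then obtain k' l' where kl: "k = Suc k'" "l = Suc l'" by (metis not0_implies_Suc)
      have "exp_poly_seq (\<mu> * \<nu>) (\<lambda>n. shift_poly [:- \<mu>, 1:] x n * y (n + 1))"
        using Suc.prems unfolding kl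
        by (intro Suc.IH[of k' _ l])
          (simp_all only: kl power_Suc2 shift_poly_mult shift_poly_arg_offset)
      moreover have "exp_poly_seq (\<mu> * \<nu>) (\<lambda>n. x n * shift_poly [:- \<nu>, 1:] y n)"
        using Suc.prems unfolding kl
        by (intro Suc.IH[of k _ l'])
          (simp_all only: kl power_Suc2 shift_poly_mult)
      ultimately have "exp_poly_seq (\<mu> * \<nu>)
          (\<lambda>n. shift_poly [:- \<mu>, 1:] x n * y (n + 1) + \<mu> * (x n * shift_poly [:- \<nu>, 1:] y n))"
        by (intro exp_poly_seq_add exp_poly_seq_cmult)
      also have "(\<lambda>n. shift_poly [:- \<mu>, 1:] x n * y (n + 1) + \<mu> * (x n * shift_poly [:- \<nu>, 1:] y n))
          = shift_poly [:- (\<mu> * \<nu>), 1:] (\<lambda>n. x n * y n)"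
        by (simp add: fun_eq_iff algebra_simps)
      finally show ?thesis
        unfolding exp_poly_seq_def shift_poly_mult[symmetric] power_Suc2[symmetric] by blast
    qed
  qed
  then show ?thesis using assms unfolding exp_poly_seq_def by blast
qed

lemma exp_poly_seq_power:
  "exp_poly_seq \<mu> x \<Longrightarrow> exp_poly_seq (\<mu> ^ k) (\<lambda>n. x n ^ k)"
  by (induction k) (auto intro: exp_poly_seq_const exp_poly_seq_mult)

lemma exp_poly_seq_prod:
  assumes "\<And>i. i \<in> I \<Longrightarrow> exp_poly_seq (\<mu> i) (x i)"
  shows "exp_poly_seq (\<Prod>i\<in>I. \<mu> i) (\<lambda>n. \<Prod>i\<in>I. x i n)"
  using assms
  by (induction I rule: infinite_finite_induct)
    (auto intro: exp_poly_seq_const exp_poly_seq_mult)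

lemma exp_poly_seq_shift_poly:
  "exp_poly_seq \<mu> x \<Longrightarrow> exp_poly_seq \<mu> (shift_poly p x)"
  unfolding exp_poly_seq_def
  by (metis mult.commute shift_poly_arg_0 shift_poly_mult)

text \<open>Applying \<open>(E - \<mu> a) ^ k\<close> kills the term \<open>x a\<close>, keeps the
  bases of the other terms, and multiplies the constant by \<open>(1 - \<mu> a) ^ k\<close>, which
  is nonzero. Removing the terms one after another leaves an empty sum.\<close>

lemma const_eq_sum_exp_poly_seq:
  fixes \<mu> :: "'b \<Rightarrow> 'a::idom"
  assumes "finite A" "\<And>a. a \<in> A \<Longrightarrow> exp_poly_seq (\<mu> a) (x a)" "\<And>a. a \<in> A \<Longrightarrow> \<mu> a \<noteq> 1"
    and "\<And>n. (\<Sum>a\<in>A. x a n) = c"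
  shows "c = 0"
  using assms
proof (induction A arbitrary: x c)
  case (insert a A)
  obtain k where k: "shift_poly ([:- \<mu> a, 1:] ^ k) (x a) = (\<lambda>n. 0)"
    using insert.prems(1) unfolding exp_poly_seq_def by blast
  let ?p = "[:- \<mu> a, 1:] ^ k"
  have "(\<Sum>b\<in>insert a A. shift_poly ?p (x b) n) = poly ?p 1 * c" for n
    unfolding shift_poly_arg_sum[symmetric, THEN fun_cong] insert.prems(3)
    using shift_poly_geometric[of ?p c 1] by (simp add: mult.commute)
  then have "(\<Sum>b\<in>A. shift_poly ?p (x b) n) = poly ?p 1 * c" for n
    using insert.hyps k by simp
  then have "poly ?p 1 * c = 0"
    using insert.prems
    by (intro insert.IH[of "\<lambda>b. shift_poly ?p (x b)"]) (auto intro: exp_poly_seq_shift_poly)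
  then show ?case using insert.prems(2)[of a] by (simp add: poly_power)
qed simp

text \<open>\<open>[:- 1, 1:]\<close> acts as the forward difference. The induction step applies the
  hypothesis to \<open>x\<close> and to its difference and combines the two sums by Pascal's rule;
  the top term left over by the index shift contains the \<open>k\<close>-th difference and
  vanishes.\<close>

lemma newton_forward_differences:
  fixes x :: "nat \<Rightarrow> 'a::comm_ring_1"
  assumes "shift_poly ([:- 1, 1:] ^ k) x = (\<lambda>n. 0)"
  shows "x n = (\<Sum>j<k. of_nat (n choose j) * shift_poly ([:- 1, 1:] ^ j) x 0)"
  using assms
proof (induction n arbitrary: x)
  case 0
  then show ?case by (cases k) (auto simp: sum.lessThan_Suc_shift simp del: sum.lessThan_Suc)
next
  case (Suc n)
  let ?D = "\<lambda>j. shift_poly ([:- 1, 1:] ^ j) x"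
  have D: "shift_poly ([:- 1, 1:] ^ j) (shift_poly [:- 1, 1:] x) = ?D (Suc j)" for j
    by (simp only: shift_poly_mult[symmetric] power_Suc2)
  show ?case
  proof (cases k)
    case 0
    then show ?thesis using Suc.prems by (simp add: fun_eq_iff)
  next
    case (Suc k')
    have "x (Suc n) = x n + shift_poly [:- 1, 1:] x n" by simp
    also have "x n = (\<Sum>j<k. of_nat (n choose j) * ?D j 0)"
      by (rule Suc.IH[OF Suc.prems])
    also have "shift_poly [:- 1, 1:] x n = (\<Sum>j<k. of_nat (n choose j) * ?D (Suc j) 0)"
      unfolding D[symmetric]
      by (rule Suc.IH) (simp only: shift_poly_mult[symmetric] mult.commute[of "_ ^ _"],
          simp only: shift_poly_mult Suc.prems shift_poly_arg_0)
    also have "(\<Sum>j<k. of_nat (n choose j) * ?D j 0) + (\<Sum>j<k. of_nat (n choose j) * ?D (Suc j) 0)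
        = (\<Sum>j<k. of_nat (Suc n choose j) * ?D j 0)"
      using Suc.prems unfolding Suc
      by (subst (1 3) sum.lessThan_Suc_shift)
        (simp add: sum.distrib algebra_simps del: power_Suc)
    finally show ?thesis .
  qed
qed

lemma of_nat_binomial_poly:
  "\<exists>p :: 'a::field_char_0 poly. \<forall>n. of_nat (n choose j) = poly p (of_nat n)"
proof -
  have "of_nat (n choose j)
      = poly (smult (inverse (fact j)) (\<Prod>i<j. [:- of_nat i, 1:])) (of_nat n :: 'a)" for n
    by (simp add: binomial_gbinomial gbinomial_prod_rev poly_prod atLeast0LessThan field_simps)
  then show ?thesis by blast
qed

lemma exp_poly_seq_1_imp_poly:
  fixes x :: "nat \<Rightarrow> 'a::field_char_0"
  assumes "exp_poly_seq 1 x"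
  shows "\<exists>p. \<forall>n. x n = poly p (of_nat n)"
proof -
  obtain k where k: "shift_poly ([:- 1, 1:] ^ k) x = (\<lambda>n. 0)"
    using assms unfolding exp_poly_seq_def by blast
  obtain b :: "nat \<Rightarrow> 'a poly" where b: "\<And>j n. of_nat (n choose j) = poly (b j) (of_nat n)"
    using of_nat_binomial_poly by metis
  have "x n = poly (\<Sum>j<k. smult (shift_poly ([:- 1, 1:] ^ j) x 0) (b j)) (of_nat n)" for n
    by (subst newton_forward_differences[OF k]) (simp add: poly_sum b mult.commute)
  then show ?thesis by blast
qed

text \<open>In characteristic 0 distinct \<open>n\<close> are distinct field elements, so the
  polynomial that interpolates \<open>x\<close> has infinitely many roots.\<close>

lemma exp_poly_seq_1_infinite_zeros:
  fixes x :: "nat \<Rightarrow> 'a::field_char_0"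
  assumes "exp_poly_seq 1 x" "infinite {n. x n = 0}"
  shows "x n = 0"
proof -
  obtain p where p: "\<And>n. x n = poly p (of_nat n)"
    using exp_poly_seq_1_imp_poly[OF assms(1)] by blast
  have "infinite ((of_nat :: nat \<Rightarrow> 'a) ` {n. x n = 0})"
    using assms(2) by (simp add: finite_image_iff inj_on_def)
  then have "infinite {a. poly p a = 0}"
    by (rule infinite_super[rotated]) (auto simp: p)
  then have "p = 0" using poly_roots_finite by blast
  then show ?thesis by (simp add: p)
qed

section \<open>Powers of matrices and polynomial functions\<close>

lemma pow_mat_Suc_left:
  assumes "A \<in> carrier_mat m m"
  shows "A ^\<^sub>m Suc n = A * A ^\<^sub>m n"
proof (induction n)
  case (Suc n)
  have "A ^\<^sub>m Suc (Suc n) = A * A ^\<^sub>m n * A" using Suc by simp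
  also have "\<dots> = A * A ^\<^sub>m Suc n"
    using assms by (simp add: assoc_mult_mat[of _ m m _ m _ m])
  finally show ?case .
qed (use assms in simp)

lemma mat_mult_index_sum:
  assumes "A \<in> carrier_mat l m" "B \<in> carrier_mat m n" "i < l" "j < n"
  shows "(A * B) $$ (i, j) = (\<Sum>k<m. A $$ (i, k) * B $$ (k, j))"
  using assms by (auto simp: scalar_prod_def atLeast0LessThan)

text \<open>On the powers of \<open>A\<close> the forward difference is multiplication by
  \<open>A - 1\<close>. This translates between nilpotency of \<open>A - 1\<close> and annihilation
  of the entry sequences, in both directions.\<close>

lemma shift_poly_pow_mat:
  fixes A :: "'a::comm_ring_1 mat"
  assumes A: "A \<in> carrier_mat m m" and ij: "i < m" "j < m"
  shows "shift_poly ([:- 1, 1:] ^ k) (\<lambda>n. (A ^\<^sub>m n) $$ (i, j))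
    = (\<lambda>n. ((A - 1\<^sub>m m) ^\<^sub>m k * A ^\<^sub>m n) $$ (i, j))"
proof (induction k)
  case 0
  then show ?case using A by simp
next
  case (Suc k)
  let ?N = "A - 1\<^sub>m m"
  have N: "?N \<in> carrier_mat m m" using A by auto
  have "(?N ^\<^sub>m k * A ^\<^sub>m Suc n) $$ (i, j) - (?N ^\<^sub>m k * A ^\<^sub>m n) $$ (i, j)
      = (?N ^\<^sub>m Suc k * A ^\<^sub>m n) $$ (i, j)" for n
  proof -
    have "?N ^\<^sub>m Suc k * A ^\<^sub>m n = ?N ^\<^sub>m k * (?N * A ^\<^sub>m n)"
      using A N by (simp add: assoc_mult_mat[of _ m m _ m _ m])
    also have "?N * A ^\<^sub>m n = A ^\<^sub>m Suc n - A ^\<^sub>m n"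
      unfolding pow_mat_Suc_left[OF A]
      using A by (subst minus_mult_distrib_mat[of _ m m _ _ m]) auto
    also have "?N ^\<^sub>m k * (A ^\<^sub>m Suc n - A ^\<^sub>m n) = ?N ^\<^sub>m k * A ^\<^sub>m Suc n - ?N ^\<^sub>m k * A ^\<^sub>m n"
      using A N
      by (intro mult_minus_distrib_mat[of _ m m _ m]) (auto simp del: pow_mat.simps)
    finally show ?thesis using ij A N by (simp del: pow_mat.simps)
  qed
  then show ?case
    unfolding power_Suc shift_poly_mult Suc.IH by (simp del: pow_mat.simps)
qed

lemma exp_poly_seq_pow_mat:
  fixes A :: "'a::comm_ring_1 mat"
  assumes "A \<in> carrier_mat m m" "(A - 1\<^sub>m m) ^\<^sub>m k = 0\<^sub>m m m" "i < m" "j < m"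
  shows "exp_poly_seq 1 (\<lambda>n. (A ^\<^sub>m n) $$ (i, j))"
proof -
  have "0\<^sub>m m m * A ^\<^sub>m n = 0\<^sub>m m m" for n using assms(1) by (simp add: left_mult_zero_mat)
  then have "shift_poly ([:- 1, 1:] ^ k) (\<lambda>n. (A ^\<^sub>m n) $$ (i, j)) = (\<lambda>n. 0)"
    using assms by (subst shift_poly_pow_mat) auto
  then show ?thesis unfolding exp_poly_seq_def by blast
qed

text \<open>Cayley-Hamilton: \<open>(E - 1) ^ m\<close> annihilates the entry sequences of the
  powers of \<open>A\<close>, and the value at \<open>n = 0\<close> is the entry of
  \<open>(A - 1) ^ m\<close>.\<close>

lemma char_poly_imp_unipotent:
  fixes A :: "'a::comm_ring_1 mat"
  assumes A: "A \<in> carrier_mat m m" and char: "char_poly A = [:- 1, 1:] ^ m"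
  shows "(A - 1\<^sub>m m) ^\<^sub>m m = 0\<^sub>m m m"
proof (rule eq_matI)
  fix i j assume ij: "i < dim_row (0\<^sub>m m m :: 'a mat)" "j < dim_col (0\<^sub>m m m :: 'a mat)"
  have "(A ^\<^sub>m Suc n) $$ (i, j) = (\<Sum>l<m. (A ^\<^sub>m n) $$ (i, l) * A $$ (l, j))" if "j < m" for j n
    using ij A that by (simp add: mat_mult_index_sum[of _ m m _ m] del: index_mult_mat)
  then have "shift_poly (char_poly A) (\<lambda>n. (A ^\<^sub>m n) $$ (i, j)) = (\<lambda>n. 0)"
    using ij A by (intro shift_poly_char_poly[of A m "\<lambda>j n. (A ^\<^sub>m n) $$ (i, j)"]) auto
  then have "((A - 1\<^sub>m m) ^\<^sub>m m * A ^\<^sub>m 0) $$ (i, j) = 0"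
    using ij A unfolding char by (subst (asm) shift_poly_pow_mat) (auto dest: fun_cong[of _ _ 0])
  then show "((A - 1\<^sub>m m) ^\<^sub>m m) $$ (i, j) = 0\<^sub>m m m $$ (i, j)"
    using ij A by simp
qed (use A in auto)

section \<open>Characteristic polynomials and eigenvectors\<close>

lemma monic_single_root:
  fixes p :: "'a::alg_closed_field poly"
  assumes "monic p" "\<And>x. poly p x = 0 \<Longrightarrow> x = a"
  shows "p = [:- a, 1:] ^ degree p"
proof -
  have "p \<noteq> 0" using assms(1) by auto
  then obtain R where R: "size R = degree p" "p = (\<Prod>x\<in>#R. [:- x, 1:])"
    using alg_closed_imp_factorization[of p] assms(1) by auto
  have "x = a" if "x \<in># R" for x
  proof (rule assms(2))
    show "poly p x = 0" using that unfolding R(2) by (auto dest!: multi_member_split)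
  qed
  then have "R = replicate_mset (degree p) a"
    unfolding R(1)[symmetric] by (intro set_mset_subset_singletonD) auto
  then show ?thesis by (subst R(2)) simp
qed

lemma char_poly_if_eigenvalues_1:
  fixes A :: "'a::alg_closed_field mat"
  assumes A: "A \<in> carrier_mat m m" and "\<And>x. eigenvalue A x \<Longrightarrow> x = 1"
  shows "char_poly A = [:- 1, 1:] ^ m"
  using monic_single_root[of "char_poly A" 1] degree_monic_char_poly[OF A] assms(2)
  by (auto simp: eigenvalue_root_char_poly[OF A])

text \<open>Write the characteristic polynomial as \<open>(X - \<mu>) ^ r * q\<close> with
  \<open>q(\<mu>) \<noteq> 0\<close>. A multiple of row \<open>i0\<close> of \<open>q(A)\<close>
  serves as \<open>\<phi>\<close>: \<open>(A - \<mu>) ^ r\<close> kills it from the right, and its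
  value at \<open>w\<close> is a multiple of \<open>w $ i0 * q(\<mu>)\<close>. A genuine left
  eigenvector would not do, as it can vanish at \<open>w\<close> when \<open>A\<close> has a Jordan
  block.\<close>

lemma left_generalized_eigenvector:
  fixes A :: "'a::field mat"
  assumes A: "A \<in> carrier_mat m m" and w: "eigenvector A w \<mu>"
  obtains \<phi> where "(\<Sum>i<m. \<phi> i * w $ i) = 1"
    "\<And>j. j < m \<Longrightarrow> exp_poly_seq \<mu> (\<lambda>n. \<Sum>i<m. \<phi> i * (A ^\<^sub>m n) $$ (i, j))"
proof -
  have wc: "w \<in> carrier_vec m" "w \<noteq> 0\<^sub>v m" "A *\<^sub>v w = \<mu> \<cdot>\<^sub>v w"
    using A w unfolding eigenvector_def by auto
  then obtain i0 where i0: "i0 < m" "w $ i0 \<noteq> 0" by force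
  define x where "x j n = (A ^\<^sub>m n) $$ (i0, j)" for j n
  have x_add: "x l (n' + n) = (\<Sum>j<m. x j n' * (A ^\<^sub>m n) $$ (j, l))" if "l < m" for l n n'
  proof -
    have "A ^\<^sub>m (n' + n) = A ^\<^sub>m n' * A ^\<^sub>m n"
    proof (induction n)
      case (Suc n)
      then show ?case using A by (simp add: assoc_mult_mat[of _ m m _ m _ m])
    qed (use A in simp)
    then show ?thesis
      using A i0 that by (simp add: x_def mat_mult_index_sum[of _ m m _ m] del: index_mult_mat)
  qed
  have x_w: "(\<Sum>j<m. x j n * w $ j) = w $ i0 * \<mu> ^ n" for n
  proof -
    have "(\<Sum>j<m. x j n * w $ j) = (A ^\<^sub>m n *\<^sub>v w) $ i0"
      using A wc i0 by (auto simp: x_def scalar_prod_def atLeast0LessThan)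
    then show ?thesis using wc i0 by (simp add: eigenvector_pow[OF A w] mult.commute)
  qed
  have cp: "char_poly A \<noteq> 0" using degree_monic_char_poly[OF A] by auto
  obtain q where q: "char_poly A = [:- \<mu>, 1:] ^ order \<mu> (char_poly A) * q"
    "\<not> [:- \<mu>, 1:] dvd q"
    using order_decomp[OF cp] by blast
  let ?c = "w $ i0 * poly q \<mu>"
  have c: "?c \<noteq> 0" using i0 q(2) by (simp add: poly_eq_0_iff_dvd)
  define \<phi> where "\<phi> j = shift_poly q (x j) 0 / ?c" for j
  show ?thesis
  proof (rule that)
    have "(\<Sum>i<m. shift_poly q (x i) 0 * w $ i) = shift_poly q (\<lambda>n. \<Sum>i<m. w $ i * x i n) 0"
      by (simp add: shift_poly_arg_sum shift_poly_arg_cmult mult.commute)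
    also have "\<dots> = ?c"
      using x_w by (simp add: shift_poly_geometric mult.commute)
    finally show "(\<Sum>i<m. \<phi> i * w $ i) = 1"
      using c by (simp add: \<phi>_def sum_divide_distrib[symmetric])
  next
    fix j assume j: "j < m"
    \<comment> \<open>Row \<open>i0\<close> of \<open>q(A) A ^ n\<close> can be computed by starting
      the sequence at \<open>n\<close> instead of 0.\<close>
    have "(\<Sum>i<m. shift_poly q (x i) 0 * (A ^\<^sub>m n) $$ (i, j)) = shift_poly q (x j) n" for n
    proof -
      have "(\<Sum>i<m. shift_poly q (x i) 0 * (A ^\<^sub>m n) $$ (i, j))
          = shift_poly q (\<lambda>n'. \<Sum>i<m. (A ^\<^sub>m n) $$ (i, j) * x i n') 0"
        by (simp add: shift_poly_arg_sum shift_poly_arg_cmult mult.commute[of "shift_poly _ _ _"])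
      also have "(\<lambda>n'. \<Sum>i<m. (A ^\<^sub>m n) $$ (i, j) * x i n') = (\<lambda>n'. x j (n' + n))"
        by (simp add: x_add[OF j] mult.commute)
      finally show ?thesis by (simp add: shift_poly_arg_offset)
    qed
    moreover have "(\<Sum>i<m. \<phi> i * (A ^\<^sub>m n) $$ (i, j))
        = inverse ?c * (\<Sum>i<m. shift_poly q (x i) 0 * (A ^\<^sub>m n) $$ (i, j))" for n
      unfolding \<phi>_def sum_distrib_left by (intro sum.cong) (auto simp: field_simps)
    ultimately have eq: "(\<lambda>n. \<Sum>i<m. \<phi> i * (A ^\<^sub>m n) $$ (i, j))
        = (\<lambda>n. inverse ?c * shift_poly q (x j) n)"
      by simp
    have "x l (Suc n) = (\<Sum>j<m. x j n * A $$ (j, l))" if "l < m" for l n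
      using x_add[OF that, of n 1] A by simp
    then have "shift_poly (char_poly A) (x j) = (\<lambda>n. 0)"
      using j by (intro shift_poly_char_poly[OF A])
    then have "exp_poly_seq \<mu> (shift_poly q (x j))"
      by (subst (asm) q(1)) (auto simp: exp_poly_seq_def shift_poly_mult)
    then show "exp_poly_seq \<mu> (\<lambda>n. \<Sum>i<m. \<phi> i * (A ^\<^sub>m n) $$ (i, j))"
      unfolding eq by (rule exp_poly_seq_cmult)
  qed
qed

section \<open>Degree bounds for polynomial functions\<close>

lemma polyfun_le_mono:
  assumes "finite I" "d \<le> e" "p \<in> polyfun_le I d"
  shows "p \<in> polyfun_le I e"
proof -
  obtain c where p: "p = (\<lambda>x. \<Sum>\<alpha>\<in>exponents I d. c \<alpha> * (\<Prod>i\<in>I. x i ^ \<alpha> i))"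
    using assms(3) unfolding polyfun_le_def by auto
  show ?thesis
    unfolding p using assms(1,2)
    by (intro polyfun_le_sum polyfun_le_monom) (auto simp: exponents_def)
qed

lemma polyfun_le_const: "finite I \<Longrightarrow> (\<lambda>x. c) \<in> polyfun_le I d"
  using polyfun_le_monom[of I "\<lambda>_. 0" d c] by simp

lemma polyfun_le_coord:
  assumes "finite I" "i \<in> I"
  shows "(\<lambda>x :: 'i \<Rightarrow> 'k::comm_ring_1. x i) \<in> polyfun_le I 1"
proof -
  have "(\<Prod>j\<in>I. x j ^ (if j = i then 1 else 0)) = x i" for x :: "'i \<Rightarrow> 'k"
    using assms by (simp add: if_distrib[of "power _"] cong: if_cong)
  then show ?thesis
    using polyfun_le_monom[of I "\<lambda>j. if j = i then 1 else 0" 1 "1 :: 'k"] assms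
    by (simp only: mult_1_left sum.delta) simp
qed

lemma polyfun_le_cmult:
  assumes "finite I" "p \<in> polyfun_le I d"
  shows "(\<lambda>x. c * p x) \<in> polyfun_le I d"
  using polyfun_le_mult[OF assms(1) polyfun_le_const[OF assms(1), of c 0] assms(2)] by simp

lemma polyfun_le_diff:
  assumes "finite I" "p \<in> polyfun_le I d" "q \<in> polyfun_le I d"
  shows "(\<lambda>x. p x - q x) \<in> polyfun_le I d"
  using polyfun_le_add[OF assms(2) polyfun_le_cmult[OF assms(1,3), of "- 1"]] by simp

lemma polyfun_le_prod:
  assumes "finite I" "\<And>s. s \<in> S \<Longrightarrow> p s \<in> polyfun_le I (d s)"
  shows "(\<lambda>x. \<Prod>s\<in>S. p s x) \<in> polyfun_le I (\<Sum>s\<in>S. d s)"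
  using assms(2)
  by (induction S rule: infinite_finite_induct)
    (auto intro: polyfun_le_const polyfun_le_mult assms(1))

lemma polyfun_le_det:
  assumes "finite I" "\<And>i j. i < n \<Longrightarrow> j < n \<Longrightarrow> F i j \<in> polyfun_le I 1"
  shows "(\<lambda>x. det (mat n n (\<lambda>(i, j). F i j x))) \<in> polyfun_le I n"
proof -
  have "(\<lambda>x. \<Prod>i = 0..<n. F i (\<pi> i) x) \<in> polyfun_le I n" if "\<pi> permutes {0..<n}" for \<pi>
    using polyfun_le_prod[OF assms(1), of "{0..<n}" "\<lambda>i. F i (\<pi> i)" "\<lambda>_. 1"] assms(2) that
    by (auto simp: permutes_in_image)
  then have "(\<lambda>x. \<Sum>\<pi> | \<pi> permutes {0..<n}. signof \<pi> * (\<Prod>i = 0..<n. F i (\<pi> i) x)) \<in> polyfun_le I n"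
    by (intro polyfun_le_sum polyfun_le_cmult assms(1)) auto
  also have "(\<lambda>x. \<Sum>\<pi> | \<pi> permutes {0..<n}. signof \<pi> * (\<Prod>i = 0..<n. F i (\<pi> i) x))
      = (\<lambda>x. det (mat n n (\<lambda>(i, j). F i j x)))"
    by (intro ext, subst det_def'[of _ n])
      (auto intro!: sum.cong prod.cong arg_cong2[of _ _ _ _ "(*)"] simp: permutes_in_image)
  finally show ?thesis .
qed

lemma exp_poly_seq_monom:
  assumes "\<And>i. i \<in> I \<Longrightarrow> exp_poly_seq (\<mu> i) (x i)"
  shows "exp_poly_seq (\<Prod>i\<in>I. \<mu> i ^ \<alpha> i) (\<lambda>n. c * (\<Prod>i\<in>I. x i n ^ \<alpha> i))"
  using assms by (intro exp_poly_seq_cmult exp_poly_seq_prod exp_poly_seq_power)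

lemma exp_poly_seq_1_polyfun:
  assumes "p \<in> polyfun I" "\<And>i. i \<in> I \<Longrightarrow> exp_poly_seq 1 (x i)"
  shows "exp_poly_seq 1 (\<lambda>n. p (\<lambda>i. x i n))"
proof -
  obtain d c where p: "p = (\<lambda>x. \<Sum>\<alpha>\<in>exponents I d. c \<alpha> * (\<Prod>i\<in>I. x i ^ \<alpha> i))"
    using assms(1) unfolding polyfun_def polyfun_le_def by auto
  show ?thesis
    unfolding p using exp_poly_seq_monom[of I "\<lambda>_. 1" x] assms(2)
    by (intro exp_poly_seq_sum) simp
qed

section \<open>Groups whose eigenvalues are roots of unity\<close>

lemma carrier_GL: "carrier (GL m) = {A \<in> carrier_mat m m. det A \<noteq> 0}"
proof -
  have "det A \<noteq> 0" if "A \<in> Units (ring_mat TYPE('a::field) m ())" for A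
    using unit_imp_det_non_zero[OF that] by auto
  moreover have "A \<in> carrier_mat m m" if "A \<in> Units (ring_mat TYPE('a::field) m ())" for A
    using that by (simp add: Units_def ring_mat_simps)
  ultimately show ?thesis
    unfolding GL_def units_of_def using det_non_zero_imp_unit by auto
qed

lemma mult_GL [simp]: "x \<otimes>\<^bsub>GL m\<^esub> y = x * y"
  by (simp add: GL_def units_of_def ring_mat_simps)

lemma one_GL [simp]: "\<one>\<^bsub>GL m\<^esub> = 1\<^sub>m m"
  by (simp add: GL_def units_of_def ring_mat_simps)

lemma group_GL: "group (GL m :: 'k::field mat monoid)"
proof -
  interpret ring "ring_mat TYPE('k) m ()" by (rule ring_mat)
  show ?thesis unfolding GL_def by (rule units_group)
qed

lemma inv_GL:
  assumes "g \<in> carrier (GL m)"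
  shows "inv\<^bsub>GL m\<^esub> g \<in> carrier_mat m m" "g * inv\<^bsub>GL m\<^esub> g = 1\<^sub>m m" "inv\<^bsub>GL m\<^esub> g * g = 1\<^sub>m m"
proof -
  interpret group "GL m" by (rule group_GL)
  show "g * inv\<^bsub>GL m\<^esub> g = 1\<^sub>m m" "inv\<^bsub>GL m\<^esub> g * g = 1\<^sub>m m"
    using r_inv[OF assms] l_inv[OF assms] by simp_all
  show "inv\<^bsub>GL m\<^esub> g \<in> carrier_mat m m" using inv_closed[OF assms] by (simp add: carrier_GL)
qed

lemma subgroup_GL_pow_mat:
  assumes "subgroup G (GL m)" "g \<in> G"
  shows "g ^\<^sub>m n \<in> G"
proof (induction n)
  case 0
  have "g \<in> carrier_mat m m" using assms subgroup.subset by (fastforce simp: carrier_GL)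
  then show ?case using subgroup.one_closed[OF assms(1)] by simp
next
  case (Suc n)
  then show ?case using subgroup.m_closed[OF assms(1) Suc assms(2)] by simp
qed

text \<open>The matrix \<open>t h - A\<close>. For invertible \<open>h\<close> its determinant is
  \<open>det h\<close> times the characteristic polynomial of the translate of \<open>A\<close> by
  the inverse of \<open>h\<close>, and its degree in the entries of \<open>A\<close> is at most
  \<open>m\<close> for every \<open>h\<close>.\<close>

definition pencil :: "nat \<Rightarrow> 'k \<Rightarrow> 'k mat \<Rightarrow> 'k mat \<Rightarrow> 'k::comm_ring_1 mat" where
  "pencil m t h A = mat m m (\<lambda>(i, j). t * h $$ (i, j) - A $$ (i, j))"

lemma pencil_carrier [simp]: "pencil m t h A \<in> carrier_mat m m"
  by (simp add: pencil_def)

lemma det_pencil_one: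
  assumes "A \<in> carrier_mat m m"
  shows "det (pencil m t (1\<^sub>m m) A) = poly (char_poly A) t"
  unfolding char_poly_def
  by (rule poly_det_cong[symmetric, of _ m])
    (use assms in \<open>auto simp: char_poly_matrix_def pencil_def\<close>)

lemma det_pencil_mult:
  assumes "h \<in> carrier_mat m m" "A \<in> carrier_mat m m"
  shows "det (pencil m t h (h * A)) = det h * poly (char_poly A) t"
proof -
  have "pencil m t h (h * A) = h * pencil m t (1\<^sub>m m) A"
  proof (rule eq_matI)
    fix i j assume "i < dim_row (h * pencil m t (1\<^sub>m m) A)" "j < dim_col (h * pencil m t (1\<^sub>m m) A)"
    then have ij: "i < m" "j < m" using assms by (auto simp: pencil_def)
    have "(h * pencil m t (1\<^sub>m m) A) $$ (i, j)
        = (\<Sum>k<m. h $$ (i, k) * pencil m t (1\<^sub>m m) A $$ (k, j))"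
      using assms ij by (intro mat_mult_index_sum) auto
    also have "\<dots> = (\<Sum>k<m. (if k = j then t * h $$ (i, j) else 0) - h $$ (i, k) * A $$ (k, j))"
      using ij by (intro sum.cong) (auto simp: pencil_def algebra_simps)
    also have "\<dots> = t * h $$ (i, j) - (h * A) $$ (i, j)"
      using assms ij by (simp add: sum_subtractf mat_mult_index_sum[of _ m m _ m] del: index_mult_mat)
    finally show "pencil m t h (h * A) $$ (i, j) = (h * pencil m t (1\<^sub>m m) A) $$ (i, j)"
      using ij by (simp add: pencil_def del: index_mult_mat)
  qed (use assms in \<open>auto simp: pencil_def\<close>)
  then show ?thesis
    using assms by (simp add: det_mult[of _ m] det_pencil_one)
qed

lemma polyfun_le_det_pencil:
  "(\<lambda>x. det (mat m m (\<lambda>(i, j). t * h $$ (i, j) - x (i, j)))) \<in> polyfun_le ({..<m} \<times> {..<m}) m"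
  by (intro polyfun_le_det polyfun_le_diff polyfun_le_const polyfun_le_coord) auto

lemma mat_poly_det_pencil: "(\<lambda>A. det (pencil m t h A)) \<in> mat_poly m"
  unfolding mat_poly_def polyfun_def pencil_def
  by (intro CollectI exI[of _ "\<lambda>x. det (mat m m (\<lambda>(i, j). t * h $$ (i, j) - x (i, j)))"])
    (intro conjI refl UN_I[of m] UNIV_I polyfun_le_det_pencil)

lemma mat_poly_diff_const:
  assumes "p \<in> mat_poly m"
  shows "(\<lambda>A. p A - c) \<in> mat_poly m"
proof -
  obtain p' d where p: "p = (\<lambda>A. p' (\<lambda>ij. A $$ ij))" "p' \<in> polyfun_le ({..<m} \<times> {..<m}) d"
    using assms unfolding mat_poly_def polyfun_def by auto
  have "(\<lambda>x. p' x - c) \<in> polyfun ({..<m} \<times> {..<m})"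
    unfolding polyfun_def using polyfun_le_diff[OF _ p(2) polyfun_le_const] by auto
  then show ?thesis
    unfolding mat_poly_def p(1) by (intro CollectI exI[of _ "\<lambda>x. p' x - c"]) auto
qed

lemma mat_poly_prod:
  assumes "\<And>s. s \<in> S \<Longrightarrow> p s \<in> mat_poly m"
  shows "(\<lambda>A. \<Prod>s\<in>S. p s A) \<in> mat_poly m"
  using assms
  by (induction S rule: infinite_finite_induct) (auto intro: mat_poly_const mat_poly_mult)

lemma finite_nontrivial_roots_of_unity:
  fixes N :: nat
  assumes "N > 0"
  shows "finite {\<zeta> :: 'k::field. \<zeta> ^ N = 1 \<and> \<zeta> \<noteq> 1}"
proof -
  have "coeff (monom 1 N - 1 :: 'k poly) N \<noteq> 0" using assms by simp
  then have "(monom 1 N - 1 :: 'k poly) \<noteq> 0" by force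
  from poly_roots_finite[OF this] show ?thesis
    by (rule finite_subset[rotated]) (auto simp: poly_monom)
qed

text \<open>A matrix whose characteristic polynomial is not \<open>(X - 1) ^ m\<close> has an
  eigenvalue other than 1, which is one of the finitely many \<open>\<zeta>\<close>. A single
  polynomial thus detects failure of unipotence.\<close>

lemma prod_char_poly_eq_0_iff:
  fixes A :: "'k::alg_closed_field mat"
  assumes A: "A \<in> carrier_mat m m" and N: "N > 0"
    and ev: "\<And>x. eigenvalue A x \<Longrightarrow> x ^ N = 1"
  shows "(\<Prod>\<zeta> | \<zeta> ^ N = 1 \<and> \<zeta> \<noteq> 1. poly (char_poly A) \<zeta>) = 0 \<longleftrightarrow> char_poly A \<noteq> [:- 1, 1:] ^ m"
proof
  show "char_poly A \<noteq> [:- 1, 1:] ^ m" if "(\<Prod>\<zeta> | \<zeta> ^ N = 1 \<and> \<zeta> \<noteq> 1. poly (char_poly A) \<zeta>) = 0"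
    using that by (auto simp: finite_nontrivial_roots_of_unity[OF N])
  assume "char_poly A \<noteq> [:- 1, 1:] ^ m"
  then obtain x where "eigenvalue A x" "x \<noteq> 1"
    using char_poly_if_eigenvalues_1[OF A] by blast
  then show "(\<Prod>\<zeta> | \<zeta> ^ N = 1 \<and> \<zeta> \<noteq> 1. poly (char_poly A) \<zeta>) = 0"
    using ev[of x]
    by (auto simp: finite_nontrivial_roots_of_unity[OF N] eigenvalue_root_char_poly[OF A])
qed

lemma char_poly_one: "char_poly (1\<^sub>m m :: 'k::comm_ring_1 mat) = [:- 1, 1:] ^ m"
  by (subst char_poly_upper_triangular[of _ m]) auto

text \<open>The set \<open>U\<close> of unipotent elements is closed by the equations
  \<open>?P\<close> and open because its complement is the zero set of \<open>?q\<close>; a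
  connected set through the identity cannot leave it.\<close>

lemma identity_component_unipotent:
  fixes G :: "'k::{alg_closed_field, field_char_0} mat set"
  assumes G: "subgroup G (GL m)" and N: "N > 0"
    and ev: "\<And>g x. g \<in> G \<Longrightarrow> eigenvalue g x \<Longrightarrow> x ^ N = 1"
  shows "unipotent m (identity_component m G)"
proof -
  define R where "R = {\<zeta> :: 'k. \<zeta> ^ N = 1 \<and> \<zeta> \<noteq> 1}"
  define U where "U = {g \<in> G. char_poly g = [:- 1, 1:] ^ m}"
  let ?X = "subtopology (zariski m) G"
  let ?d = "\<lambda>t A. det (pencil m t (1\<^sub>m m) A)"
  have GL: "G \<subseteq> carrier (GL m)" using G by (rule subgroup.subset)
  then have Gc: "g \<in> carrier_mat m m" if "g \<in> G" for g using that by (auto simp: carrier_GL)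
  have eq_iff: "char_poly g = [:- 1, 1:] ^ m \<longleftrightarrow> (\<forall>t. ?d t g - (t - 1) ^ m = 0)" if "g \<in> G" for g
  proof
    assume "\<forall>t. ?d t g - (t - 1) ^ m = 0"
    then have "poly (char_poly g) = poly ([:- 1, 1:] ^ m)"
      by (auto simp: det_pencil_one[OF Gc[OF that]] poly_power fun_eq_iff)
    then show "char_poly g = [:- 1, 1:] ^ m"
      by (simp only: poly_eq_poly_eq_iff)
  qed (simp add: det_pencil_one[OF Gc[OF that]] poly_power)
  \<comment> \<open>\<open>?P\<close> has one equation for each \<open>t\<close>: over an infinite
    field these values determine the characteristic polynomial.\<close>
  let ?P = "{\<lambda>A. ?d t A - (t - 1) ^ m |t. True}" and ?q = "\<lambda>A. \<Prod>\<zeta>\<in>R. ?d \<zeta> A"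
  have "?P \<subseteq> mat_poly m" by (auto intro!: mat_poly_diff_const mat_poly_det_pencil)
  then have "closedin (zariski m) (zero_locus m ?P)" unfolding closedin_zariski by blast
  moreover have "U = zero_locus m ?P \<inter> G"
  proof -
    have "zero_locus m ?P = {A \<in> carrier (GL m). \<forall>t. ?d t A - (t - 1) ^ m = 0}"
      unfolding zero_locus_def by (intro Collect_cong conj_cong refl) fast
    then show ?thesis unfolding U_def using GL eq_iff by blast
  qed
  ultimately have closed: "closedin ?X U" unfolding closedin_subtopology by blast
  have "{?q} \<subseteq> mat_poly m" by (auto intro!: mat_poly_prod mat_poly_det_pencil)
  then have "openin (zariski m) (carrier (GL m) - zero_locus m {?q})"
    unfolding openin_zariski by blast
  moreover have "?q g \<noteq> 0 \<longleftrightarrow> char_poly g = [:- 1, 1:] ^ m" if "g \<in> G" for g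
    unfolding R_def det_pencil_one[OF Gc[OF that]]
    using prod_char_poly_eq_0_iff[OF Gc[OF that] N ev[OF that]] by blast
  then have "g \<in> U \<longleftrightarrow> g \<in> (carrier (GL m) - zero_locus m {?q}) \<inter> G" for g
    unfolding U_def zero_locus_def using GL by (cases "g \<in> G") auto
  then have "U = (carrier (GL m) - zero_locus m {?q}) \<inter> G" by blast
  ultimately have "openin ?X U" unfolding openin_subtopology by blast
  have one: "1\<^sub>m m \<in> U"
    using subgroup.one_closed[OF G] by (simp add: U_def char_poly_one)
  show ?thesis
    unfolding unipotent_def
  proof
    fix A assume "A \<in> identity_component m G"
    then obtain T where T: "connectedin ?X T" "1\<^sub>m m \<in> T" "A \<in> T"
      by (auto simp: identity_component_def connected_component_of_def)
    have "closedin ?X (topspace ?X - U)" using \<open>openin ?X U\<close> by blast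
    moreover have "T \<subseteq> topspace ?X" using T(1) by (rule connectedin_subset_topspace)
    ultimately have "A \<in> U"
      using T closed one unfolding connectedin_closedin[of ?X T] by blast
    then show "\<exists>k. (A - 1\<^sub>m m) ^\<^sub>m k = 0\<^sub>m m m"
      using char_poly_imp_unipotent[OF Gc] by (auto simp: U_def)
  qed
qed

text \<open>Finitely many vectors of \<open>S\<close> span the same space as \<open>S\<close>. The
  proof is Gaussian elimination: a vector \<open>x0\<close> with a nonzero coordinate
  \<open>j\<close> serves as pivot, \<open>r\<close> clears this coordinate, and the induction
  hypothesis treats the remaining ones.\<close>

lemma finite_detecting_subset:
  fixes S :: "('i \<Rightarrow> 'k::field) set"
  assumes "finite I"
  shows "\<exists>X\<subseteq>S. finite X \<and>
    (\<forall>c. (\<forall>x\<in>X. (\<Sum>i\<in>I. c i * x i) = 0) \<longrightarrow> (\<forall>x\<in>S. (\<Sum>i\<in>I. c i * x i) = 0))"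
  using assms
proof (induction I arbitrary: S)
  case empty
  then show ?case by auto
next
  case (insert j I)
  show ?case
  proof (cases "\<forall>x\<in>S. x j = 0")
    case True
    have eq: "(\<Sum>i\<in>insert j I. c i * x i) = (\<Sum>i\<in>I. c i * x i)" if "x \<in> S" for c x
      using insert.hyps True that by simp
    obtain X where "X \<subseteq> S" "finite X"
      "\<forall>c. (\<forall>x\<in>X. (\<Sum>i\<in>I. c i * x i) = 0) \<longrightarrow> (\<forall>x\<in>S. (\<Sum>i\<in>I. c i * x i) = 0)"
      using insert.IH by meson
    then show ?thesis using eq by (intro exI[of _ X]) (simp add: subset_eq)
  next
    case False
    then obtain x0 where x0: "x0 \<in> S" "x0 j \<noteq> 0" by blast
    define r where "r x i = x i - x j / x0 j * x0 i" for x i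
    have r: "(\<Sum>i\<in>I. c i * r x i)
        = (\<Sum>i\<in>insert j I. c i * x i) - x j / x0 j * (\<Sum>i\<in>insert j I. c i * x0 i)" for c x
    proof -
      have "(\<Sum>i\<in>I. c i * r x i) = (\<Sum>i\<in>insert j I. c i * r x i)"
        using insert.hyps x0 by (simp add: r_def)
      also have "\<dots> = (\<Sum>i\<in>insert j I. c i * x i) - x j / x0 j * (\<Sum>i\<in>insert j I. c i * x0 i)"
        by (simp only: r_def sum_distrib_left sum_subtractf[symmetric])
          (intro sum.cong, auto simp: algebra_simps)
      finally show ?thesis .
    qed
    obtain X' where X': "X' \<subseteq> r ` S" "finite X'"
      "\<forall>c. (\<forall>x\<in>X'. (\<Sum>i\<in>I. c i * x i) = 0) \<longrightarrow> (\<forall>x\<in>r ` S. (\<Sum>i\<in>I. c i * x i) = 0)"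
      using insert.IH by meson
    obtain X where X: "X \<subseteq> S" "finite X" "X' = r ` X"
      using finite_subset_image[OF X'(2,1)] by blast
    have "\<forall>x\<in>S. (\<Sum>i\<in>insert j I. c i * x i) = 0"
      if c: "\<forall>x\<in>insert x0 X. (\<Sum>i\<in>insert j I. c i * x i) = 0" for c
    proof -
      have "\<forall>x\<in>X'. (\<Sum>i\<in>I. c i * x i) = 0"
        unfolding X(3) using c by (simp add: r del: sum.insert)
      then have "\<forall>x\<in>S. (\<Sum>i\<in>I. c i * r x i) = 0" using X'(3) by blast
      then show ?thesis using c by (simp add: r del: sum.insert)
    qed
    then show ?thesis
      using X x0 by (intro exI[of _ "insert x0 X"]) blast
  qed
qed

text \<open>The function \<open>p\<^sub>h\<close> below vanishes on \<open>G\<close> exactly off \<open>h\<close>. All these functions lie in one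
  space of polynomials of bounded degree, and they are linearly independent.\<close>

lemma finite_if_unipotent_trivial:
  fixes G :: "'k::alg_closed_field mat set"
  assumes G: "subgroup G (GL m)" and N: "N > 0"
    and ev: "\<And>g x. g \<in> G \<Longrightarrow> eigenvalue g x \<Longrightarrow> x ^ N = 1"
    and triv: "\<And>u. u \<in> G \<Longrightarrow> (u - 1\<^sub>m m) ^\<^sub>m m = 0\<^sub>m m m \<Longrightarrow> u = 1\<^sub>m m"
  shows "finite G"
proof -
  define R where "R = {\<zeta> :: 'k. \<zeta> ^ N = 1 \<and> \<zeta> \<noteq> 1}"
  define p where "p h A = (\<Prod>\<zeta>\<in>R. det (pencil m \<zeta> h A))" for h A :: "'k mat"
  have R: "finite R" unfolding R_def by (rule finite_nontrivial_roots_of_unity[OF N])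
  have GL: "G \<subseteq> carrier (GL m)" using G by (rule subgroup.subset)
  then have Gc: "g \<in> carrier_mat m m" "det g \<noteq> 0" if "g \<in> G" for g
    using that by (auto simp: carrier_GL)
  have p_mult: "p h (h * u) = 0 \<longleftrightarrow> (\<Prod>\<zeta>\<in>R. poly (char_poly u) \<zeta>) = 0" if "h \<in> G" "u \<in> G" for h u
    using Gc that R by (simp add: p_def det_pencil_mult)
  \<comment> \<open>Up to a nonzero factor, \<open>p h g\<close> is the detecting product for
    \<open>u\<close>, the inverse of \<open>h\<close> times \<open>g\<close>. It is nonzero only if
    \<open>u\<close> is unipotent, hence only if \<open>u\<close> is the identity.\<close>
  have p_eq_0_iff: "p h g = 0 \<longleftrightarrow> g \<noteq> h" if hg: "h \<in> G" "g \<in> G" for h g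
  proof -
    define u where "u = inv\<^bsub>GL m\<^esub> h * g"
    have u: "u \<in> G"
      using subgroup.m_closed[OF G subgroup.m_inv_closed[OF G hg(1)] hg(2)] by (simp add: u_def)
    have g: "g = h * u"
      using inv_GL[of h m] GL hg Gc
      by (simp add: u_def subset_eq assoc_mult_mat[of _ m m _ m _ m, symmetric] left_mult_one_mat[of _ m m])
    have "p h g = 0 \<longleftrightarrow> char_poly u \<noteq> [:- 1, 1:] ^ m"
      using prod_char_poly_eq_0_iff[OF Gc(1)[OF u] N ev[OF u]] p_mult[OF hg(1) u]
      unfolding g R_def by simp
    also have "\<dots> \<longleftrightarrow> u \<noteq> 1\<^sub>m m"
      using triv[OF u] char_poly_imp_unipotent[OF Gc(1)[OF u]] char_poly_one by blast
    also have "\<dots> \<longleftrightarrow> g \<noteq> h"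
    proof -
      have "u = 1\<^sub>m m" if "g = h" using inv_GL(3)[of h m] GL hg that by (auto simp: u_def)
      moreover have "g = h" if "u = 1\<^sub>m m" using g Gc(1)[OF hg(1)] that by simp
      ultimately show ?thesis by blast
    qed
    finally show ?thesis .
  qed
  \<comment> \<open>The bound \<open>?d\<close>, that is \<open>card R * m\<close>, is the same for
    all \<open>h\<close>, so all coefficient families \<open>c h\<close> live on one finite index
    set.\<close>
  let ?I = "{..<m} \<times> {..<m}" and ?d = "\<Sum>\<zeta>\<in>R. m"
  let ?E = "exponents ?I ?d"
  define mon where "mon A \<alpha> = (\<Prod>ij\<in>?I. A $$ ij ^ \<alpha> ij)" for A :: "'k mat" and \<alpha>
  have "\<exists>c. \<forall>A. p h A = (\<Sum>\<alpha>\<in>?E. c \<alpha> * mon A \<alpha>)" for h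
  proof -
    have "(\<lambda>x. \<Prod>\<zeta>\<in>R. det (mat m m (\<lambda>(i, j). \<zeta> * h $$ (i, j) - x (i, j)))) \<in> polyfun_le ?I ?d"
      by (intro polyfun_le_prod polyfun_le_det_pencil) auto
    then obtain c where "(\<lambda>x. \<Prod>\<zeta>\<in>R. det (mat m m (\<lambda>(i, j). \<zeta> * h $$ (i, j) - x (i, j))))
        = (\<lambda>x. \<Sum>\<alpha>\<in>?E. c \<alpha> * (\<Prod>ij\<in>?I. x ij ^ \<alpha> ij))"
      unfolding polyfun_le_def by blast
    from fun_cong[OF this] show ?thesis
      unfolding p_def pencil_def mon_def by (intro exI[of _ c]) simp
  qed
  then obtain c where c: "\<And>h A. p h A = (\<Sum>\<alpha>\<in>?E. c h \<alpha> * mon A \<alpha>)" by metis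
  have "finite ?E" by (intro finite_exponents) auto
  then obtain X' where X': "X' \<subseteq> mon ` G" "finite X'"
    "\<forall>c. (\<forall>x\<in>X'. (\<Sum>\<alpha>\<in>?E. c \<alpha> * x \<alpha>) = 0) \<longrightarrow> (\<forall>x\<in>mon ` G. (\<Sum>\<alpha>\<in>?E. c \<alpha> * x \<alpha>) = 0)"
    using finite_detecting_subset[of ?E "mon ` G"] by meson
  obtain X where X: "X \<subseteq> G" "finite X" "X' = mon ` X"
    using finite_subset_image[OF X'(2,1)] by blast
  \<comment> \<open>For \<open>h\<close> outside \<open>X\<close> the function \<open>p h\<close>
    would vanish on \<open>X\<close>, hence on all of \<open>G\<close>, including \<open>h\<close>
    itself.\<close>
  have "h \<in> X" if h: "h \<in> G" for h
  proof (rule ccontr)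
    assume "h \<notin> X"
    then have "\<forall>g\<in>X. p h g = 0" using p_eq_0_iff[OF h] X(1) by auto
    then have "\<forall>x\<in>X'. (\<Sum>\<alpha>\<in>?E. c h \<alpha> * x \<alpha>) = 0" by (simp add: X(3) c)
    then have "p h h = 0" using X'(3) h by (simp add: c)
    then show False using p_eq_0_iff[OF h h] by simp
  qed
  then show ?thesis using X(2) by (meson finite_subset subsetI)
qed

lemma infinite_identity_component:
  fixes G :: "'k::field_char_0 mat set"
  assumes G: "subgroup G (GL m)" and u: "u \<in> G" "u \<noteq> 1\<^sub>m m"
    and nil: "(u - 1\<^sub>m m) ^\<^sub>m k = 0\<^sub>m m m"
  shows "infinite (identity_component m G)"
proof -
  define C where "C = range (\<lambda>n. u ^\<^sub>m n)"
  have GL: "G \<subseteq> carrier (GL m)" using G by (rule subgroup.subset)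
  have uc: "u \<in> carrier_mat m m" using u GL by (auto simp: carrier_GL)
  have CG: "C \<subseteq> G" using subgroup_GL_pow_mat[OF G u(1)] by (auto simp: C_def)
  note seq = exp_poly_seq_pow_mat[OF uc nil]
  \<comment> \<open>Along the powers of \<open>u\<close> a polynomial function has base 1, so it is
    a polynomial in the exponent.\<close>
  have zeros: "p (u ^\<^sub>m n) = 0" if p: "p \<in> mat_poly m" "infinite {n. p (u ^\<^sub>m n) = 0}" for p n
  proof -
    obtain p' where p': "p = (\<lambda>A. p' (\<lambda>ij. A $$ ij))" "p' \<in> polyfun ({..<m} \<times> {..<m})"
      using p(1) unfolding mat_poly_def by blast
    have "exp_poly_seq 1 (\<lambda>n. p (u ^\<^sub>m n))"
      unfolding p'(1)
      by (rule exp_poly_seq_1_polyfun[OF p'(2), of "\<lambda>ij n. (u ^\<^sub>m n) $$ ij"]) (auto intro: seq)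
    then show ?thesis using exp_poly_seq_1_infinite_zeros p(2) by blast
  qed
  have "infinite C"
  proof
    assume "finite C"
    \<comment> \<open>Some power recurs infinitely often; then every entry is a constant polynomial
      in the exponent, which forces \<open>u = 1\<close>.\<close>
    then obtain a where a: "infinite {n. u ^\<^sub>m n = u ^\<^sub>m a}"
      using pigeonhole_infinite[of UNIV "\<lambda>n. u ^\<^sub>m n"] by (auto simp: C_def)
    have "u ^\<^sub>m n = u ^\<^sub>m a" for n
    proof (rule eq_matI)
      fix i j assume ij: "i < dim_row (u ^\<^sub>m a)" "j < dim_col (u ^\<^sub>m a)"
      have "exp_poly_seq 1 (\<lambda>n. (u ^\<^sub>m n) $$ (i, j) + - (u ^\<^sub>m a) $$ (i, j))"
        using ij pow_mat_dim_square[OF uc] by (intro exp_poly_seq_add seq exp_poly_seq_const) auto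
      moreover have "infinite {n. (u ^\<^sub>m n) $$ (i, j) + - (u ^\<^sub>m a) $$ (i, j) = 0}"
        using a by (rule infinite_super[rotated]) auto
      ultimately show "(u ^\<^sub>m n) $$ (i, j) = (u ^\<^sub>m a) $$ (i, j)"
        using exp_poly_seq_1_infinite_zeros by fastforce
    qed (use uc in auto)
    then have "u ^\<^sub>m 0 = u ^\<^sub>m 1" by metis
    then show False using u(2) uc by simp
  qed
  moreover have "C \<subseteq> identity_component m G"
  proof -
    have irred: "C \<subseteq> E" if "closedin (zariski m) E" "infinite {n. u ^\<^sub>m n \<in> E}" for E
    proof -
      obtain P where P: "P \<subseteq> mat_poly m" "E = zero_locus m P"
        using \<open>closedin (zariski m) E\<close> unfolding closedin_zariski by blast
      have "p (u ^\<^sub>m n) = 0" if "p \<in> P" for p n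
      proof (rule zeros)
        show "infinite {n. p (u ^\<^sub>m n) = 0}"
          using \<open>infinite {n. u ^\<^sub>m n \<in> E}\<close>
          by (rule infinite_super[rotated]) (use that in \<open>auto simp: P(2) zero_locus_def\<close>)
      qed (use that P in auto)
      then show ?thesis using CG GL by (auto simp: C_def P(2) zero_locus_def)
    qed
    have "connectedin (zariski m) C"
      unfolding connectedin_closedin
    proof (intro conjI notI)
      show "C \<subseteq> topspace (zariski m)" using CG GL by (simp add: topspace_zariski)
      assume "\<exists>E1 E2. closedin (zariski m) E1 \<and> closedin (zariski m) E2 \<and> C \<subseteq> E1 \<union> E2 \<and>
        E1 \<inter> E2 \<inter> C = {} \<and> E1 \<inter> C \<noteq> {} \<and> E2 \<inter> C \<noteq> {}"
      then obtain E1 E2 where E: "closedin (zariski m) E1" "closedin (zariski m) E2"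
        "C \<subseteq> E1 \<union> E2" "E1 \<inter> E2 \<inter> C = {}" "E1 \<inter> C \<noteq> {}" "E2 \<inter> C \<noteq> {}" by blast
      \<comment> \<open>One of the two closed sets contains infinitely many powers, hence all of
        \<open>C\<close>, and leaves no point of \<open>C\<close> to the other.\<close>
      have "UNIV = {n. u ^\<^sub>m n \<in> E1} \<union> {n. u ^\<^sub>m n \<in> E2}"
        using E(3) by (auto simp: C_def)
      then have "infinite {n. u ^\<^sub>m n \<in> E1} \<or> infinite {n. u ^\<^sub>m n \<in> E2}"
        by (metis finite_UnI infinite_UNIV_nat)
      then show False using irred[OF E(1)] irred[OF E(2)] E(4-6) by blast
    qed
    moreover have "1\<^sub>m m \<in> C" unfolding C_def using uc by (intro range_eqI[of _ _ 0]) simp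
    ultimately show ?thesis
      unfolding identity_component_def using CG
      by (intro connected_component_of_maximal) (auto simp: connectedin_subtopology)
  qed
  ultimately show ?thesis using finite_subset by blast
qed

section \<open>The dual plus a tensor power of the natural module\<close>

text \<open>Matrix indices are initial segments of the naturals, so the multi-indices of the basis
  tensors have to be numbered; the numbering is arbitrary.\<close>

lemma exists_multi_index_bij:
  "\<exists>e :: nat \<Rightarrow> nat \<Rightarrow> nat. bij_betw e {..<m ^ b} ({..<b} \<rightarrow>\<^sub>E {..<m})"
  by (rule finite_same_card_bij) (auto simp: card_PiE finite_PiE)

definition tensor_mat :: "(nat \<Rightarrow> nat \<Rightarrow> nat) \<Rightarrow> nat \<Rightarrow> nat \<Rightarrow> 'k::comm_ring_1 mat \<Rightarrow> 'k mat" where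
  "tensor_mat e m b A = mat (m ^ b) (m ^ b) (\<lambda>(I, J). \<Prod>s<b. A $$ (e I s, e J s))"

definition tensor_vec :: "(nat \<Rightarrow> nat \<Rightarrow> nat) \<Rightarrow> nat \<Rightarrow> nat \<Rightarrow> 'k::comm_ring_1 vec \<Rightarrow> 'k vec" where
  "tensor_vec e m b w = vec (m ^ b) (\<lambda>I. \<Prod>s<b. w $ (e I s))"

lemma tensor_carrier [simp]:
  "tensor_mat e m b A \<in> carrier_mat (m ^ b) (m ^ b)" "tensor_vec e m b w \<in> carrier_vec (m ^ b)"
  "dim_vec (tensor_vec e m b w) = m ^ b"
  by (simp_all add: tensor_mat_def tensor_vec_def)

text \<open>The direct sum of the dual of the natural module and its \<open>b\<close>-th tensor power; \<open>e\<close> numbers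
  the basis of the tensor power.\<close>

definition dual_tensor_rep ::
  "(nat \<Rightarrow> nat \<Rightarrow> nat) \<Rightarrow> nat \<Rightarrow> nat \<Rightarrow> 'k::field mat \<Rightarrow> 'k mat" where
  "dual_tensor_rep e m b g = four_block_mat (transpose_mat (inv\<^bsub>GL m\<^esub> g))
     (0\<^sub>m m (m ^ b)) (0\<^sub>m (m ^ b) m) (tensor_mat e m b g)"

lemma mat_poly_index:
  assumes "i < m" "j < m"
  shows "(\<lambda>A. A $$ (i, j)) \<in> mat_poly m"
proof -
  have "(\<lambda>x. x (i, j)) \<in> polyfun ({..<m} \<times> {..<m})"
    unfolding polyfun_def using assms by (intro UN_I[of 1] UNIV_I polyfun_le_coord) auto
  then show ?thesis
    unfolding mat_poly_def by (intro CollectI exI[of _ "\<lambda>x. x (i, j)"]) auto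
qed

lemma inv_GL_entry_regular:
  fixes i j :: nat
  assumes "i < m" "j < m"
  shows "\<exists>p\<in>mat_poly m. \<forall>g\<in>carrier (GL m). (inv\<^bsub>GL m\<^esub> g) $$ (i, j) = p g / (det g :: 'k::field)"
proof -
  \<comment> \<open>Cramer's rule: \<open>r k\<close> lists the indices other than \<open>k\<close>,
    so \<open>F\<close> gives the entries of the minor without row \<open>j\<close> and column
    \<open>i\<close>.\<close>
  define r where "r k l = (if l < k then l else Suc l)" for k l :: nat
  define F where "F i' j' x = (x :: nat \<times> nat \<Rightarrow> 'k) (r j i', r i j')" for i' j' x
  define p where "p x = (- 1) ^ (j + i) * det (mat (m - 1) (m - 1) (\<lambda>(i', j'). F i' j' x))" for x
  have "p \<in> polyfun ({..<m} \<times> {..<m})"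
    unfolding polyfun_def p_def F_def
    by (intro UN_I[of "m - 1"] UNIV_I polyfun_le_cmult polyfun_le_det polyfun_le_coord)
      (auto simp: r_def)
  then have "(\<lambda>A. p (\<lambda>ij. A $$ ij)) \<in> mat_poly m" unfolding mat_poly_def by blast
  moreover have "(inv\<^bsub>GL m\<^esub> g) $$ (i, j) = p (\<lambda>ij. g $$ ij) / det g" if g: "g \<in> carrier (GL m)" for g
  proof -
    have gc: "g \<in> carrier_mat m m" "det g \<noteq> 0" using g by (auto simp: carrier_GL)
    note inv = inv_GL[OF g] and adj = adj_mat[OF gc(1)]
    have "mat_delete g j i = mat (m - 1) (m - 1) (\<lambda>(i', j'). F i' j' (\<lambda>ij. g $$ ij))"
      using gc by (auto simp: mat_delete_def F_def r_def)
    then have "adj_mat g $$ (i, j) = p (\<lambda>ij. g $$ ij)"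
      using gc assms by (simp add: adj_mat_def cofactor_def p_def)
    moreover have "adj_mat g = det g \<cdot>\<^sub>m inv\<^bsub>GL m\<^esub> g"
    proof -
      have "adj_mat g = inv\<^bsub>GL m\<^esub> g * g * adj_mat g" using inv adj(1) by simp
      also have "\<dots> = inv\<^bsub>GL m\<^esub> g * (det g \<cdot>\<^sub>m 1\<^sub>m m)"
        using inv(1) adj gc by (simp add: assoc_mult_mat[of _ m m _ m _ m])
      also have "\<dots> = det g \<cdot>\<^sub>m inv\<^bsub>GL m\<^esub> g"
        using inv(1) by (simp add: mult_smult_distrib[of _ m m _ m])
      finally show ?thesis .
    qed
    ultimately show ?thesis using assms inv(1) gc(2) by (auto simp: field_simps)
  qed
  ultimately show ?thesis by (intro bexI[of _ "\<lambda>A. p (\<lambda>ij. A $$ ij)"]) auto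
qed

context
  fixes e :: "nat \<Rightarrow> nat \<Rightarrow> nat" and m b :: nat
  assumes e: "bij_betw e {..<m ^ b} ({..<b} \<rightarrow>\<^sub>E {..<m})"
begin

lemma e_less: "I < m ^ b \<Longrightarrow> s < b \<Longrightarrow> e I s < m"
  using bij_betwE[OF e] by (fastforce simp: PiE_iff)

text \<open>The distributive law, expanding a product of sums over all choice functions. It yields
  the multiplicativity of the tensor power and its compatibility with vectors and pairings.\<close>

lemma sum_multi_index:
  "(\<Sum>I<m ^ b. \<Prod>s<b. F s (e I s)) = (\<Prod>s<b. \<Sum>i<m. F s i :: 'k::comm_ring_1)"
  using sum.reindex_bij_betw[OF e, of "\<lambda>h. \<Prod>s<b. F s (h s)"] by (simp add: prod_sum_PiE)

lemma tensor_mat_mult: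
  assumes "A \<in> carrier_mat m m" "B \<in> carrier_mat m m"
  shows "tensor_mat e m b (A * B) = tensor_mat e m b A * tensor_mat e m b B"
proof (rule eq_matI)
  fix I J assume "I < dim_row (tensor_mat e m b A * tensor_mat e m b B)"
    "J < dim_col (tensor_mat e m b A * tensor_mat e m b B)"
  then have IJ: "I < m ^ b" "J < m ^ b" by (auto simp: tensor_mat_def)
  have "(tensor_mat e m b A * tensor_mat e m b B) $$ (I, J)
      = (\<Sum>K<m ^ b. \<Prod>s<b. A $$ (e I s, e K s) * B $$ (e K s, e J s))"
    using IJ by (subst mat_mult_index_sum[of _ "m ^ b" "m ^ b" _ "m ^ b"])
      (auto simp: tensor_mat_def prod.distrib)
  also have "\<dots> = (\<Prod>s<b. \<Sum>k<m. A $$ (e I s, k) * B $$ (k, e J s))"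
    by (rule sum_multi_index)
  also have "\<dots> = tensor_mat e m b (A * B) $$ (I, J)"
    using IJ assms
    by (auto simp: tensor_mat_def mat_mult_index_sum[of _ m m _ m] e_less
        simp del: index_mult_mat intro!: prod.cong)
  finally show "tensor_mat e m b (A * B) $$ (I, J)
      = (tensor_mat e m b A * tensor_mat e m b B) $$ (I, J)" by simp
qed (auto simp: tensor_mat_def)

lemma tensor_mat_one: "tensor_mat e m b (1\<^sub>m m) = (1\<^sub>m (m ^ b) :: 'k::comm_ring_1 mat)"
proof (rule eq_matI)
  fix I J assume "I < dim_row (1\<^sub>m (m ^ b) :: 'k mat)" "J < dim_col (1\<^sub>m (m ^ b) :: 'k mat)"
  then have IJ: "I < m ^ b" "J < m ^ b" by auto
  have "(\<Prod>s<b. (1\<^sub>m m :: 'k mat) $$ (e I s, e J s)) = (if I = J then 1 else 0)"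
  proof (cases "I = J")
    case False
    have "e I \<noteq> e J" using False e IJ by (auto simp: bij_betw_def inj_on_def)
    moreover have "e I \<in> {..<b} \<rightarrow>\<^sub>E {..<m}" "e J \<in> {..<b} \<rightarrow>\<^sub>E {..<m}"
      using IJ bij_betwE[OF e] by auto
    ultimately obtain s where "s < b" "e I s \<noteq> e J s"
      by (metis PiE_ext lessThan_iff)
    then have "(1\<^sub>m m :: 'k mat) $$ (e I s, e J s) = 0" using IJ e_less by simp
    then show ?thesis using False \<open>s < b\<close> by (auto intro: prod_zero)
  qed (use IJ e_less in simp)
  then show "tensor_mat e m b (1\<^sub>m m) $$ (I, J) = (1\<^sub>m (m ^ b) :: 'k mat) $$ (I, J)"
    using IJ by (simp add: tensor_mat_def)
qed (auto simp: tensor_mat_def)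

lemma tensor_mat_transpose:
  assumes "A \<in> carrier_mat m m"
  shows "tensor_mat e m b (transpose_mat A) = transpose_mat (tensor_mat e m b A)"
  using assms by (auto simp: tensor_mat_def e_less intro!: eq_matI prod.cong)

lemma tensor_mat_vec:
  assumes "A \<in> carrier_mat m m" "w \<in> carrier_vec m"
  shows "tensor_mat e m b A *\<^sub>v tensor_vec e m b w = tensor_vec e m b (A *\<^sub>v w)"
proof (rule eq_vecI)
  fix I assume "I < dim_vec (tensor_vec e m b (A *\<^sub>v w))"
  then have I: "I < m ^ b" by (simp add: tensor_vec_def)
  have "(tensor_mat e m b A *\<^sub>v tensor_vec e m b w) $ I
      = (\<Sum>J<m ^ b. \<Prod>s<b. A $$ (e I s, e J s) * w $ (e J s))"
    using I by (simp add: tensor_mat_def tensor_vec_def scalar_prod_def atLeast0LessThan prod.distrib)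
  also have "\<dots> = (\<Prod>s<b. \<Sum>j<m. A $$ (e I s, j) * w $ j)" by (rule sum_multi_index)
  also have "\<dots> = tensor_vec e m b (A *\<^sub>v w) $ I"
    using I assms by (auto simp: tensor_vec_def scalar_prod_def atLeast0LessThan e_less intro!: prod.cong)
  finally show "(tensor_mat e m b A *\<^sub>v tensor_vec e m b w) $ I = tensor_vec e m b (A *\<^sub>v w) $ I" .
qed (simp add: tensor_mat_def tensor_vec_def)

lemma tensor_vec_smult:
  assumes "w \<in> carrier_vec m"
  shows "tensor_vec e m b (c \<cdot>\<^sub>v w) = c ^ b \<cdot>\<^sub>v tensor_vec e m b w"
  using assms by (auto simp: tensor_vec_def e_less prod.distrib intro!: eq_vecI)

lemma tensor_vec_scalar_prod:
  assumes "u \<in> carrier_vec m" "w \<in> carrier_vec m"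
  shows "tensor_vec e m b u \<bullet> tensor_vec e m b w = (u \<bullet> w) ^ b"
proof -
  have "tensor_vec e m b u \<bullet> tensor_vec e m b w = (\<Sum>I<m ^ b. \<Prod>s<b. u $ (e I s) * w $ (e I s))"
    by (simp add: tensor_vec_def scalar_prod_def atLeast0LessThan prod.distrib)
  also have "\<dots> = (\<Prod>s<b. \<Sum>i<m. u $ i * w $ i)" by (rule sum_multi_index)
  finally show ?thesis using assms by (simp add: scalar_prod_def atLeast0LessThan)
qed

lemma dual_tensor_rep_carrier:
  assumes "g \<in> carrier (GL m)"
  shows "dual_tensor_rep e m b g \<in> carrier_mat (m + m ^ b) (m + m ^ b)"
  unfolding dual_tensor_rep_def using inv_GL(1)[OF assms] by (intro four_block_carrier_mat) auto

lemma dual_tensor_rep_apply: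
  assumes "g \<in> carrier (GL m)" "u \<in> carrier_vec m" "c \<in> carrier_vec (m ^ b)"
  shows "dual_tensor_rep e m b g *\<^sub>v (u @\<^sub>v c)
    = (transpose_mat (inv\<^bsub>GL m\<^esub> g) *\<^sub>v u) @\<^sub>v (tensor_mat e m b g *\<^sub>v c)"
  unfolding dual_tensor_rep_def using assms inv_GL(1)[OF assms(1)]
  by (intro mult_mat_vec_split) auto

lemma dual_tensor_rep_mult:
  assumes g: "g \<in> carrier (GL m)" and h: "h \<in> carrier (GL m)"
  shows "dual_tensor_rep e m b (g * h) = dual_tensor_rep e m b g * dual_tensor_rep e m b h"
proof -
  interpret group "GL m" by (rule group_GL)
  note ig = inv_GL(1)[OF g] and ih = inv_GL(1)[OF h]
  have c: "g \<in> carrier_mat m m" "h \<in> carrier_mat m m" using g h by (auto simp: carrier_GL)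
  have "inv\<^bsub>GL m\<^esub> (g * h) = inv\<^bsub>GL m\<^esub> h * inv\<^bsub>GL m\<^esub> g"
    using inv_mult_group[OF g h] by simp
  then have "transpose_mat (inv\<^bsub>GL m\<^esub> (g * h))
      = transpose_mat (inv\<^bsub>GL m\<^esub> g) * transpose_mat (inv\<^bsub>GL m\<^esub> h)"
    using transpose_mult[OF ih ig] by simp
  moreover have "transpose_mat (inv\<^bsub>GL m\<^esub> g) \<in> carrier_mat m m" "transpose_mat (inv\<^bsub>GL m\<^esub> h) \<in> carrier_mat m m"
    using ig ih by simp_all
  ultimately show ?thesis
    unfolding dual_tensor_rep_def tensor_mat_mult[OF c]
    by (subst mult_four_block_mat[of _ m m _ "m ^ b" _ "m ^ b" _ _ m _ "m ^ b"])
      (simp_all add: left_mult_zero_mat[OF tensor_carrier(1)] right_mult_zero_mat[OF tensor_carrier(1)]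
        left_add_zero_mat[OF mult_carrier_mat[OF tensor_carrier(1) tensor_carrier(1)]])
qed

lemma dual_tensor_rep_one: "dual_tensor_rep e m b (1\<^sub>m m) = (1\<^sub>m (m + m ^ b) :: 'k::field mat)"
proof -
  interpret group "GL m :: 'k mat monoid" by (rule group_GL)
  have "inv\<^bsub>GL m\<^esub> (1\<^sub>m m :: 'k mat) = 1\<^sub>m m" using inv_one by simp
  then show ?thesis by (simp add: dual_tensor_rep_def tensor_mat_one)
qed

lemma dual_tensor_rep_GL:
  assumes g: "g \<in> carrier (GL m)"
  shows "dual_tensor_rep e m b g \<in> carrier (GL (m + m ^ b))"
proof -
  interpret group "GL m" by (rule group_GL)
  have "dual_tensor_rep e m b g * dual_tensor_rep e m b (inv\<^bsub>GL m\<^esub> g) = 1\<^sub>m (m + m ^ b)"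
    unfolding dual_tensor_rep_mult[OF g inv_closed[OF g], symmetric] inv_GL(2)[OF g]
    by (rule dual_tensor_rep_one)
  then have "det (dual_tensor_rep e m b g) * det (dual_tensor_rep e m b (inv\<^bsub>GL m\<^esub> g)) = 1"
    using det_mult[OF dual_tensor_rep_carrier[OF g] dual_tensor_rep_carrier[OF inv_closed[OF g]]]
    by simp
  then show ?thesis using dual_tensor_rep_carrier[OF g] by (auto simp: carrier_GL)
qed

lemma G_module_dual_tensor_rep:
  fixes G :: "'k::field mat set"
  assumes G: "subgroup G (GL m)"
  shows "G_module m G (m + m ^ b) (dual_tensor_rep e m b)"
  unfolding G_module_def
proof (intro conjI allI impI)
  have GL: "G \<subseteq> carrier (GL m)" using G by (rule subgroup.subset)
  show "dual_tensor_rep e m b \<in> hom (GL m\<lparr>carrier := G\<rparr>) (GL (m + m ^ b))"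
    using GL by (intro homI) (auto simp: dual_tensor_rep_GL dual_tensor_rep_mult subset_eq)
  fix i j assume ij: "i < m + m ^ b" "j < m + m ^ b"
  let ?P = "\<lambda>f :: 'k mat \<Rightarrow> 'k. \<exists>p\<in>mat_poly m. \<exists>N. \<forall>g\<in>G. f g = p g / det g ^ N"
  have index: "dual_tensor_rep e m b g $$ (i, j) =
      (if i < m then if j < m then (inv\<^bsub>GL m\<^esub> g) $$ (j, i) else 0
       else if j < m then 0 else \<Prod>s<b. g $$ (e (i - m) s, e (j - m) s))" if "g \<in> G" for g
  proof -
    have "inv\<^bsub>GL m\<^esub> g \<in> carrier_mat m m" using inv_GL(1) that GL by blast
    then show ?thesis using ij by (auto simp: dual_tensor_rep_def tensor_mat_def)
  qed
  \<comment> \<open>Dual entries are regular with denominator \<open>det g\<close>, by Cramer's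
    rule; the tensor entries are polynomials.\<close>
  consider (dual) "i < m" "j < m" | (tensor) "\<not> i < m" "\<not> j < m" | (off) "(i < m) \<noteq> (j < m)" by blast
  then show "?P (\<lambda>g. dual_tensor_rep e m b g $$ (i, j))"
  proof cases
    case dual
    obtain p where p: "p \<in> mat_poly m"
      "\<forall>g\<in>carrier (GL m). (inv\<^bsub>GL m\<^esub> g) $$ (j, i) = p g / (det g :: 'k)"
      using inv_GL_entry_regular[OF dual(2,1)] by blast
    then show ?thesis
      using dual GL by (intro bexI[of _ p] exI[of _ 1]) (auto simp: index)
  next
    case tensor
    then have "(\<lambda>g :: 'k mat. \<Prod>s<b. g $$ (e (i - m) s, e (j - m) s)) \<in> mat_poly m"
      using ij by (intro mat_poly_prod mat_poly_index e_less) auto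
    then show ?thesis
      using tensor by (intro bexI[of _ "\<lambda>g. \<Prod>s<b. g $$ (e (i - m) s, e (j - m) s)"] exI[of _ 0])
        (auto simp: index)
  next
    case off
    then show ?thesis
      using mat_poly_const[of 0 m] by (intro bexI[of _ "\<lambda>_. 0"] exI[of _ 0]) (auto simp: index)
  qed
qed

text \<open>The invariant \<open>(u, c) \<mapsto> c(u, \<dots>, u)\<close>.\<close>

definition evaluation_inv :: "'k::field vec \<Rightarrow> 'k" where
  "evaluation_inv = (\<lambda>x\<in>carrier_vec (m + m ^ b). \<Sum>I<m ^ b. x $ (m + I) * (\<Prod>s<b. x $ (e I s)))"

lemma evaluation_inv_append:
  assumes "u \<in> carrier_vec m" "c \<in> carrier_vec (m ^ b)"
  shows "evaluation_inv (u @\<^sub>v c) = tensor_vec e m b u \<bullet> c"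
proof -
  have "(u @\<^sub>v c) $ (e I s) = u $ (e I s)" if "I < m ^ b" "s < b" for I s
    using e_less[OF that] assms by auto
  then show ?thesis
    using assms
    by (auto simp: evaluation_inv_def tensor_vec_def scalar_prod_def atLeast0LessThan mult.commute
        intro!: sum.cong arg_cong2[of _ _ _ _ "(*)"] prod.cong)
qed

text \<open>The function pairs the tensor power of \<open>u\<close> with \<open>c\<close>. Moving
  the tensor power of \<open>g\<close> across the pairing transposes it, and there it cancels the
  inverse transpose acting on \<open>u\<close>.\<close>

lemma evaluation_inv_invariant:
  fixes G :: "'k::field mat set"
  assumes G: "subgroup G (GL m)"
  shows "evaluation_inv \<in> invariants m G (m + m ^ b) (dual_tensor_rep e m b)"
proof -
  interpret group "GL m :: 'k mat monoid" by (rule group_GL)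
  let ?n = "m + m ^ b"
  have "(\<lambda>x :: nat \<Rightarrow> 'k. \<Sum>I<m ^ b. x (m + I) * (\<Prod>s<b. x (e I s))) \<in> polyfun_le {..<?n} (1 + (\<Sum>s<b. 1))"
    by (intro polyfun_le_sum polyfun_le_mult polyfun_le_prod polyfun_le_coord)
      (auto intro: trans_less_add1 e_less)
  then have "(evaluation_inv :: 'k vec \<Rightarrow> 'k) \<in> coord_ring ?n"
    unfolding coord_ring_def polyfun_def evaluation_inv_def
    by (intro CollectI exI[of _ "\<lambda>x. \<Sum>I<m ^ b. x (m + I) * (\<Prod>s<b. x (e I s))"] conjI refl
        UN_I[of "1 + (\<Sum>s<b. 1)"] UNIV_I)
  moreover have inv: "evaluation_inv (dual_tensor_rep e m b g *\<^sub>v x) = evaluation_inv x"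
    if g: "g \<in> carrier (GL m)" and x: "x \<in> carrier_vec ?n" for g :: "'k mat" and x
  proof -
    define u c where "u = vec_first x m" and "c = vec_last x (m ^ b)"
    have uc: "u \<in> carrier_vec m" "c \<in> carrier_vec (m ^ b)" "x = u @\<^sub>v c"
      using x by (auto simp: u_def c_def)
    have gc: "g \<in> carrier_mat m m" using g by (auto simp: carrier_GL)
    note inv = inv_GL[OF g]
    let ?u = "transpose_mat (inv\<^bsub>GL m\<^esub> g) *\<^sub>v u"
    have u': "?u \<in> carrier_vec m" using inv(1) uc by auto
    have "evaluation_inv (dual_tensor_rep e m b g *\<^sub>v x) = tensor_vec e m b ?u \<bullet> (tensor_mat e m b g *\<^sub>v c)"
      using u' by (simp add: uc(3) dual_tensor_rep_apply[OF g uc(1,2)] evaluation_inv_append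
          mult_mat_vec_carrier[OF tensor_carrier(1) uc(2)])
    also have "\<dots> = (transpose_mat (tensor_mat e m b g) *\<^sub>v tensor_vec e m b ?u) \<bullet> c"
      by (rule transpose_vec_mult_scalar[symmetric, of _ "m ^ b" "m ^ b"]) (use uc in auto)
    also have "transpose_mat (tensor_mat e m b g) *\<^sub>v tensor_vec e m b ?u
        = tensor_vec e m b (transpose_mat g *\<^sub>v ?u)"
      using gc u' by (simp add: tensor_mat_transpose[symmetric] tensor_mat_vec)
    also have "transpose_mat g *\<^sub>v ?u = transpose_mat (inv\<^bsub>GL m\<^esub> g * g) *\<^sub>v u"
      using gc inv(1) uc by (simp add: transpose_mult[OF inv(1) gc] assoc_mult_mat_vec[of _ m m _ m])
    also have "\<dots> = u" using uc by (simp add: inv(3))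
    finally show ?thesis using uc by (simp add: evaluation_inv_append)
  qed
  \<comment> \<open>\<open>act\<close> substitutes the inverse, which again lies in
    \<open>GL m\<close>; off the carrier both sides are \<open>undefined\<close>.\<close>
  moreover have "act m ?n (dual_tensor_rep e m b) g evaluation_inv = evaluation_inv" if "g \<in> G" for g
  proof
    fix x :: "'k vec"
    have "inv\<^bsub>GL m\<^esub> g \<in> carrier (GL m)" using that subgroup.subset[OF G] by blast
    then show "act m ?n (dual_tensor_rep e m b) g evaluation_inv x = evaluation_inv x"
      using inv unfolding act_def
      by (cases "x \<in> carrier_vec ?n") (simp_all only: restrict_apply if_True if_False,
        simp add: evaluation_inv_def)
  qed
  ultimately show ?thesis unfolding invariants_def by blast
qed

end

section \<open>Orders of eigenvalues\<close>

text \<open>If no \<open>d \<le> D\<close> worked, the infimum for this module would be at least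
  \<open>D + 1\<close>, also when it is taken over the empty set.\<close>

lemma sigma_set_if_sigma_group_le:
  assumes "sigma_group m G \<le> enat D" "G_module m G n \<rho>"
  shows "\<exists>d\<le>D. sigma_set m G n \<rho> (invariants_le m G n \<rho> d)"
proof (rule ccontr)
  let ?A = "{d. sigma_set m G n \<rho> (invariants_le m G n \<rho> d)}"
  assume none: "\<not> ?thesis"
  have "enat (Suc D) \<le> enat d" if "d \<in> ?A" for d
    using none that not_less_eq_eq by auto
  then have "enat (Suc D) \<le> (INF d\<in>?A. enat d)" by (intro INF_greatest)
  also have "\<dots> \<le> sigma_group m G"
    unfolding sigma_group_def sigma_module_def[symmetric]
    using assms(2) by (intro SUP_upper2[of "(n, \<rho>)"]) auto
  finally show False using assms(1) by (meson enat_ord_simps(1) not_less_eq_eq order_refl order_trans)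
qed

lemma invariant_apply:
  assumes "f \<in> invariants m G n \<rho>" "g \<in> G" "x \<in> carrier_vec n"
  shows "f (\<rho> (inv\<^bsub>GL m\<^esub> g) *\<^sub>v x) = f x"
proof -
  have "act m n \<rho> g f x = f x" using assms(1,2) unfolding invariants_def by simp
  then show ?thesis using assms(3) by (simp add: act_def)
qed

text \<open>The weight is \<mu> to the exponent \<open>s - b t\<close>. For \<open>t = 0\<close>
  this is \<open>s\<close>, between 1 and \<open>D\<close>; for \<open>t > 0\<close> one has
  \<open>s \<le> D < b \<le> b t\<close>, so its absolute value lies between 1 and
  \<open>b D\<close>.\<close>

lemma power_weight_neq_1:
  fixes \<mu> :: "'k::field"
  assumes \<mu>: "\<mu> \<noteq> 0" and order: "\<And>k. 1 \<le> k \<Longrightarrow> k \<le> b * D \<Longrightarrow> \<mu> ^ k \<noteq> 1"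
    and st: "s + t \<le> D" "0 < s + t" and b: "D < b"
  shows "\<mu> ^ s * (inverse \<mu> ^ b) ^ t \<noteq> 1"
proof
  assume "\<mu> ^ s * (inverse \<mu> ^ b) ^ t = 1"
  then have eq: "\<mu> ^ s = \<mu> ^ (b * t)"
    using \<mu> by (simp add: power_mult[symmetric] power_inverse field_simps)
  show False
  proof (cases "t = 0")
    case True
    have "D \<le> b * D" using b by (cases b) auto
    then have "s \<le> b * D" using st by linarith
    then show False using order[of s] eq True st by auto
  next
    case False
    then have "b \<le> b * t" "b * t \<le> b * D" using st by auto
    then have le: "s < b * t" using st b by linarith
    have "\<mu> ^ s * \<mu> ^ (b * t - s) = \<mu> ^ (b * t)"
      using le by (simp flip: power_add)
    then have "\<mu> ^ s * \<mu> ^ (b * t - s) = \<mu> ^ s * 1" using eq by simp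
    then have "\<mu> ^ (b * t - s) = 1" using \<mu> by simp
    then show False using order[of "b * t - s"] le \<open>b * t \<le> b * D\<close> by auto
  qed
qed

text \<open>Along the orbit of \<open>v\<close> under the powers of \<open>g\<close>, the monomial with exponent \<open>\<alpha>\<close> is an
  exponential polynomial with base \<open>\<mu>\<close> to the power \<open>s - b t\<close>, where \<open>s\<close> and \<open>t\<close> are its degrees in
  the two summands. If \<open>s + t \<le> D\<close> this base differs from \<open>1\<close> unless \<open>s = t = 0\<close>, so an invariant
  of degree at most \<open>D\<close> without constant term, being constant along the orbit, vanishes at \<open>v\<close>.\<close>

lemma eigenvalue_order_bounded:
  fixes G :: "'k::field mat set"
  assumes G: "subgroup G (GL m)" and sigma: "sigma_group m G \<le> enat D"
    and g: "g \<in> G" and ev: "eigenvalue g \<mu>"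
  shows "\<exists>k\<ge>1. k \<le> Suc D * D \<and> \<mu> ^ k = 1"
proof (rule ccontr)
  assume "\<not> ?thesis"
  then have order: "\<mu> ^ k \<noteq> 1" if "1 \<le> k" "k \<le> Suc D * D" for k using that by blast
  \<comment> \<open>With \<open>b > D\<close>, at most \<open>D\<close> factors of weight \<mu>
    cannot balance one factor of weight \<mu> to the power \<open>- b\<close>.\<close>
  define b where "b = Suc D"
  define n where "n = m + m ^ b"
  obtain e :: "nat \<Rightarrow> nat \<Rightarrow> nat" where e: "bij_betw e {..<m ^ b} ({..<b} \<rightarrow>\<^sub>E {..<m})"
    using exists_multi_index_bij by blast
  let ?\<rho> = "dual_tensor_rep e m b"
  have GL: "G \<subseteq> carrier (GL m)" using G by (rule subgroup.subset)
  have gc: "g \<in> carrier_mat m m" using g GL by (auto simp: carrier_GL)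
  obtain w where w: "eigenvector g w \<mu>" using ev unfolding eigenvalue_def by blast
  then have wc: "w \<in> carrier_vec m" "w \<noteq> 0\<^sub>v m" "g *\<^sub>v w = \<mu> \<cdot>\<^sub>v w"
    using gc unfolding eigenvector_def by auto
  have inv_apply: "inv\<^bsub>GL m\<^esub> h *\<^sub>v (h *\<^sub>v w) = w" if "h \<in> carrier (GL m)" for h
    using inv_GL[OF that] wc that
    by (simp add: carrier_GL assoc_mult_mat_vec[of _ m m _ m, symmetric])
  have \<mu>: "\<mu> \<noteq> 0"
  proof
    assume "\<mu> = 0"
    then have "g *\<^sub>v w = 0\<^sub>v m" using wc by auto
    moreover have "inv\<^bsub>GL m\<^esub> g *\<^sub>v 0\<^sub>v m = 0\<^sub>v m"
      using inv_GL(1)[of g m] g GL by (intro eq_vecI) auto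
    ultimately have "w = 0\<^sub>v m" using inv_apply[of g] g GL by auto
    then show False using wc by simp
  qed
  obtain \<phi> where \<phi>: "(\<Sum>i<m. \<phi> i * w $ i) = 1"
    "\<And>j. j < m \<Longrightarrow> exp_poly_seq \<mu> (\<lambda>n. \<Sum>i<m. \<phi> i * (g ^\<^sub>m n) $$ (i, j))"
    using left_generalized_eigenvector[OF gc w] by blast
  define u where "u = vec m \<phi>"
  have uc: "u \<in> carrier_vec m" by (simp add: u_def)
  define v where "v = u @\<^sub>v tensor_vec e m b w"
  have vc: "v \<in> carrier_vec n" using uc by (simp add: v_def n_def)
  \<comment> \<open>The invariant takes the value \<open>(u \<bullet> w) ^ b = 1\<close> at
    \<open>v\<close>, so \<open>v\<close> lies outside the nullcone.\<close>
  have "u \<bullet> w = 1" using wc \<phi>(1) by (simp add: u_def scalar_prod_def atLeast0LessThan)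
  then have "evaluation_inv e m b v = 1"
    using uc wc by (simp add: v_def evaluation_inv_append[OF e] tensor_vec_scalar_prod[OF e])
  moreover have "evaluation_inv e m b (0\<^sub>v n :: 'k vec) = 0"
    by (simp add: evaluation_inv_def[OF e] n_def)
  then have "evaluation_inv e m b \<in> plus_part n (invariants m G n ?\<rho>)"
    using evaluation_inv_invariant[OF e G] by (simp add: plus_part_def n_def)
  ultimately have "v \<in> carrier_vec n - nullcone m G n ?\<rho>"
    using vc by (force simp: nullcone_def)
  moreover obtain d where d: "d \<le> D" "sigma_set m G n ?\<rho> (invariants_le m G n ?\<rho> d)"
    using sigma_set_if_sigma_group_le[OF sigma G_module_dual_tensor_rep[OF e G]] by (auto simp: n_def)
  ultimately obtain f where f: "f \<in> invariants m G n ?\<rho>" "f \<in> coord_ring_le n d"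
    "f (0\<^sub>v n) = 0" "f v \<noteq> 0"
    unfolding sigma_set_def plus_part_def invariants_le_def by blast
  obtain p where p: "f = (\<lambda>v\<in>carrier_vec n. p (\<lambda>i. v $ i))" "p \<in> polyfun_le {..<n} d"
    using f(2) unfolding coord_ring_le_def by blast
  have "p \<in> polyfun_le {..<n} D" using p(2) d(1) polyfun_le_mono by blast
  then obtain c where c: "p = (\<lambda>x. \<Sum>\<alpha>\<in>exponents {..<n} D. c \<alpha> * (\<Prod>i<n. x i ^ \<alpha> i))"
    unfolding polyfun_le_def by blast
  \<comment> \<open>The coordinates of \<open>v\<close> moved by the inverse of
    \<open>g ^ k\<close>: the dual part becomes the row \<phi> times \<open>g ^ k\<close>, the
    tensor part is scaled by the \<open>b k\<close>-th power of the inverse of \<mu>.\<close>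
  define x where "x i k = (if i < m then \<Sum>l<m. \<phi> l * (g ^\<^sub>m k) $$ (l, i)
    else tensor_vec e m b w $ (i - m) * (inverse \<mu> ^ b) ^ k)" for i k
  define wt where "wt i = (if i < m then \<mu> else inverse \<mu> ^ b)" for i
  have x: "exp_poly_seq (wt i) (x i)" for i
    using \<phi>(2) exp_poly_seq_geometric unfolding x_def[abs_def] wt_def by (cases "i < m") auto
  define mon where "mon \<alpha> k = c \<alpha> * (\<Prod>i<n. x i k ^ \<alpha> i)" for \<alpha> k
  \<comment> \<open>The zero exponent has to be restricted, since members of
    \<open>exponents\<close> are \<open>undefined\<close> off the index set.\<close>
  define z :: "nat \<Rightarrow> nat" where "z = (\<lambda>i\<in>{..<n}. 0)"
  have z: "z \<in> exponents {..<n} D" by (simp add: z_def exponents_def)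
  have z_iff: "\<alpha> = z \<longleftrightarrow> (\<forall>i<n. \<alpha> i = 0)" if "\<alpha> \<in> exponents {..<n} D" for \<alpha>
    using that by (auto simp: z_def exponents_def PiE_def extensional_def fun_eq_iff)
  define E where "E = exponents {..<n} D - {z}"
  have fin: "finite (exponents {..<n} D)" by (rule finite_exponents) simp
  have const: "(\<Sum>\<alpha>\<in>exponents {..<n} D. mon \<alpha> k) = f v" for k
  proof -
    have gk: "g ^\<^sub>m k \<in> G" "g ^\<^sub>m k \<in> carrier (GL m)" "g ^\<^sub>m k \<in> carrier_mat m m"
      using subgroup_GL_pow_mat[OF G g] GL gc by auto
    interpret group "GL m :: 'k mat monoid" by (rule group_GL)
    let ?h = "inv\<^bsub>GL m\<^esub> (g ^\<^sub>m k)"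
    have h: "?h \<in> carrier (GL m)" "?h \<in> carrier_mat m m" "inv\<^bsub>GL m\<^esub> ?h = g ^\<^sub>m k"
      using gk inv_GL by auto
    have "\<mu> ^ k \<cdot>\<^sub>v (?h *\<^sub>v w) = w"
      using inv_apply[OF gk(2)] mult_mat_vec[OF h(2) wc(1)] by (simp add: eigenvector_pow[OF gc w])
    then have "inverse \<mu> ^ k \<cdot>\<^sub>v (\<mu> ^ k \<cdot>\<^sub>v (?h *\<^sub>v w)) = inverse \<mu> ^ k \<cdot>\<^sub>v w" by simp
    then have hw: "?h *\<^sub>v w = inverse \<mu> ^ k \<cdot>\<^sub>v w"
      using \<mu> by (simp add: smult_smult_assoc power_mult_distrib[symmetric])
    define y where "y = ?\<rho> ?h *\<^sub>v v"
    have y: "y = (transpose_mat (g ^\<^sub>m k) *\<^sub>v u) @\<^sub>v ((inverse \<mu> ^ k) ^ b \<cdot>\<^sub>v tensor_vec e m b w)"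
      unfolding y_def v_def using h uc wc
      by (simp add: dual_tensor_rep_apply[OF e] tensor_mat_vec[OF e] hw tensor_vec_smult[OF e])
    have yc: "y \<in> carrier_vec n"
      unfolding y n_def using gk(3) uc by (intro append_carrier_vec) auto
    have "y $ i = x i k" if "i < n" for i
    proof (cases "i < m")
      case True
      then have "y $ i = (\<Sum>l<m. (g ^\<^sub>m k) $$ (l, i) * \<phi> l)"
        using carrier_matD[OF gk(3)]
        by (simp add: y u_def scalar_prod_def atLeast0LessThan del: pow_mat_dim)
      then show ?thesis using True by (simp add: x_def mult.commute)
    next
      case False
      then have "i - m < m ^ b" using that by (auto simp: n_def)
      then show ?thesis
        using False that carrier_matD[OF gk(3)]
        by (simp add: y x_def n_def power_mult[symmetric] mult.commute del: pow_mat_dim)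
    qed
    then have "f y = (\<Sum>\<alpha>\<in>exponents {..<n} D. mon \<alpha> k)"
      using yc by (simp add: p(1) c mon_def)
    moreover have "f y = f v"
      unfolding y_def by (rule invariant_apply[OF f(1) gk(1) vc])
    ultimately show ?thesis by simp
  qed
  \<comment> \<open>The constant monomial is the only one with base 1 among degrees at most
    \<open>D\<close>; its coefficient is \<open>f\<close> at the origin.\<close>
  have c0: "c z = 0"
  proof -
    have "f (0\<^sub>v n) = (\<Sum>\<alpha>\<in>exponents {..<n} D. if \<alpha> = z then c \<alpha> else 0)"
    proof -
      have "(\<Prod>i<n. (0\<^sub>v n :: 'k vec) $ i ^ \<alpha> i) = (if \<alpha> = z then 1 else 0)"
        if "\<alpha> \<in> exponents {..<n} D" for \<alpha>
      proof (cases "\<forall>i<n. \<alpha> i = 0")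
        case True
        then show ?thesis using z_iff[OF that] by simp
      next
        case False
        then obtain i where "i < n" "\<alpha> i \<noteq> 0" by blast
        then show ?thesis using z_iff[OF that] by (auto intro!: prod_zero bexI[of _ i])
      qed
      then show ?thesis by (auto simp: p(1) c intro!: sum.cong)
    qed
    also have "\<dots> = c z"
      using fin z by simp
    finally show ?thesis using f(3) by simp
  qed
  have "f v = 0"
  proof (rule const_eq_sum_exp_poly_seq[of E "\<lambda>\<alpha>. \<Prod>i<n. wt i ^ \<alpha> i" mon])
    show "finite E" using fin by (simp add: E_def)
    show "exp_poly_seq (\<Prod>i<n. wt i ^ \<alpha> i) (mon \<alpha>)" for \<alpha>
      unfolding mon_def[abs_def] by (rule exp_poly_seq_monom) (rule x)
    show "(\<Sum>\<alpha>\<in>E. mon \<alpha> k) = f v" for k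
    proof -
      have "mon z k = 0" by (simp add: mon_def c0)
      then have "(\<Sum>\<alpha>\<in>E. mon \<alpha> k) = (\<Sum>\<alpha>\<in>exponents {..<n} D. mon \<alpha> k)"
        unfolding E_def using fin by (intro sum.mono_neutral_left) auto
      then show ?thesis by (simp add: const)
    qed
    show "(\<Prod>i<n. wt i ^ \<alpha> i) \<noteq> 1" if "\<alpha> \<in> E" for \<alpha>
    proof -
      have split: "{..<n} = {..<m} \<union> {m..<n}" "{..<m} \<inter> {m..<n} = {}" by (auto simp: n_def)
      let ?s = "\<Sum>i<m. \<alpha> i" and ?t = "\<Sum>i=m..<n. \<alpha> i"
      have sum: "(\<Sum>i<n. \<alpha> i) = ?s + ?t"
        unfolding split(1) by (rule sum.union_disjoint) (use split in auto)
      have "(\<Prod>i<n. wt i ^ \<alpha> i) = (\<Prod>i<m. wt i ^ \<alpha> i) * (\<Prod>i=m..<n. wt i ^ \<alpha> i)"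
        unfolding split(1) by (rule prod.union_disjoint) (use split in auto)
      also have "\<dots> = \<mu> ^ ?s * (inverse \<mu> ^ b) ^ ?t"
        by (simp add: wt_def power_sum)
      finally have prod: "(\<Prod>i<n. wt i ^ \<alpha> i) = \<mu> ^ ?s * (inverse \<mu> ^ b) ^ ?t" .
      have le: "?s + ?t \<le> D" using that sum by (simp add: E_def exponents_def)
      have "?s + ?t \<noteq> 0"
      proof
        assume "?s + ?t = 0"
        then have "\<forall>i<n. \<alpha> i = 0" unfolding sum[symmetric] by simp
        then show False using that z_iff[of \<alpha>] by (simp add: E_def)
      qed
      then have pos: "0 < ?s + ?t" by (rule neq0_conv[THEN iffD1])
      show ?thesis
        unfolding prod
      proof (rule power_weight_neq_1[OF \<mu> _ le pos])
        show "\<mu> ^ k \<noteq> 1" if "1 \<le> k" "k \<le> b * D" for k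
          using order[of k] that unfolding b_def by blast
        show "D < b" by (simp add: b_def)
      qed
    qed
  qed
  then show False using f(4) by simp
qed

theorem theorem1p6:
  fixes m :: nat and G :: "'k::{alg_closed_field, field_char_0} mat set"
  assumes "linear_algebraic_group m G"
    and "sigma_group m G < \<infinity>"
  shows "unipotent m (identity_component m G) \<and>
    (finite G \<or> infinite (identity_component m G) \<and> unipotent m (identity_component m G))"
proof -
  have G: "subgroup G (GL m)" using assms(1) by (simp add: linear_algebraic_group_def)
  obtain D where D: "sigma_group m G = enat D" using assms(2) by auto
  \<comment> \<open>The factorial is a common multiple of all exponents \<open>k\<close> that the
    bound on orders permits.\<close>
  define N :: nat where "N = fact (Suc D * D)"
  have N: "N > 0" by (simp add: N_def)
  have ev: "x ^ N = 1" if gx: "g \<in> G" "eigenvalue g x" for g x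
  proof -
    obtain k where "k \<ge> 1" "k \<le> Suc D * D" "x ^ k = 1"
      using eigenvalue_order_bounded[OF G _ gx, of D] D by auto
    moreover from this have "k dvd N" unfolding N_def by (intro dvd_fact) auto
    ultimately show ?thesis by (auto simp: dvd_def power_mult)
  qed
  have "unipotent m (identity_component m G)"
    by (rule identity_component_unipotent[OF G N ev])
  moreover have "finite G \<or> infinite (identity_component m G)"
  \<comment> \<open>A nontrivial unipotent element makes the identity component infinite; without
    one \<open>G\<close> is finite.\<close>
  proof (cases "\<exists>u\<in>G. u \<noteq> 1\<^sub>m m \<and> (u - 1\<^sub>m m) ^\<^sub>m m = 0\<^sub>m m m")
    case True
    then show ?thesis using infinite_identity_component[OF G] by blast
  next
    case False
    then have "finite G" by (intro finite_if_unipotent_trivial[OF G N]) (auto intro: ev)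
    then show ?thesis ..
  qed
  ultimately show ?thesis by blast
qed

end
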